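(* Let $V, W \subset \mathbb{R}^2$ be two polygons with vertices $\mathbf{v}_1,\dots,\mathbf{v}_n$ and $\mathbf{w}_1,\dots,\mathbf{w}_n$ respectively, each list arranged in counter-clockwise order along the boundary, and suppose $W$ is convex. Let $\phi_1,\dots,\phi_n$ be the harmonic generalized barycentric coordinate (GBC) functions over $V$, and let $$\mathbf{F}(x,y)=\sum_{i=1}^n \phi_i(x,y)\,\mathbf{w}_i,\qquad (x,y)\in V.$$ Then $\mathbf{F}$ is a diffeomorphism from the interior $\mathring{V}$ of $V$ onto the interior $\mathring{W}$ of $W$.
   Context: A polygon means a compact region in $\mathbb{R}^2$ (including its boundary) with nonempty interior bounded by a simple closed polygonal curve; it need not be convex unless stated. GBC functions over a polygon $V$ with vertices $\mathbf{v}_1,\dots,\mathbf{v}_n$ are functions $\phi_1,\dots,\phi_n$ on $V$ such that, for all $\mathbf{x}\in V$, $\sum_{i=1}^n\phi_i(\mathbf{x})=1$, $\sum_{i=1}^n\phi_i(\mathbf{x})\mathbf{v}_i=\mathbf{x}$, $\phi_i(\mathbf{x})\ge 0$ for every $i$, and such that each $\phi_i$ is linear on every edge of $V$ with $\phi_i(\mathbf{v}_j)=1$ if $i=j$ and $0$ if $i\neq j$. They are called harmonic GBC functions if in addition each $\phi_i$ is continuous on $V$ and harmonic ($\Delta\phi_i=0$) in the interior of $V$. *)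

theory Defs
  imports "HOL-Complex_Analysis.Complex_Analysis"
begin

text \<open>The Euclidean plane is represented by the type of complex numbers, regarded only as a
  two-dimensional real Euclidean space: all derivatives below are real (Frechet) derivatives.\<close>

subsection \<open>Polygons\<close>

fun polyline :: "complex list \<Rightarrow> real \<Rightarrow> complex" where
  "polyline [] = linepath 0 0"
| "polyline [a] = linepath a a"
| "polyline [a, b] = linepath a b"
| "polyline (a # b # c # vs) = linepath a b +++ polyline (b # c # vs)"

definition closed_polyline :: "complex list \<Rightarrow> real \<Rightarrow> complex" where
  "closed_polyline vs = polyline (vs @ [hd vs])"

text \<open>Since \<^term>\<open>closed_polyline vs\<close> is a closed path, \<^const>\<open>simple_path\<close> says that it is a simple
  closed curve. Consecutive edges may be collinear.\<close>

definition polygon :: "complex set \<Rightarrow> complex list \<Rightarrow> bool" where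
  "polygon V vs \<longleftrightarrow>
     3 \<le> length vs \<and> simple_path (closed_polyline vs) \<and>
     compact V \<and> interior V \<noteq> {} \<and> frontier V = path_image (closed_polyline vs)"

definition counterclockwise :: "complex set \<Rightarrow> complex list \<Rightarrow> bool" where
  "counterclockwise V vs \<longleftrightarrow>
     (\<forall>z\<in>interior V. winding_number (closed_polyline vs) z = 1)"

subsection \<open>Smoothness, harmonicity, diffeomorphisms\<close>

text \<open>Only used on open sets \<open>S\<close> of a finite-dimensional domain, where it is the usual class
  \<open>C\<^sup>k\<close>.\<close>

primrec Ck_on :: "nat \<Rightarrow> 'a::euclidean_space set \<Rightarrow> ('a \<Rightarrow> 'b::real_normed_vector) \<Rightarrow> bool" where
  "Ck_on 0 S f \<longleftrightarrow> continuous_on S f"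
| "Ck_on (Suc k) S f \<longleftrightarrow>
     (\<forall>x\<in>S. f differentiable at x) \<and>
     (\<forall>v. Ck_on k S (\<lambda>x. frechet_derivative f (at x) v))"

definition smooth_on :: "'a::euclidean_space set \<Rightarrow> ('a \<Rightarrow> 'b::real_normed_vector) \<Rightarrow> bool" where
  "smooth_on S f \<longleftrightarrow> (\<forall>k. Ck_on k S f)"

definition laplacian :: "('a::euclidean_space \<Rightarrow> real) \<Rightarrow> 'a \<Rightarrow> real" where
  "laplacian f x =
     (\<Sum>b\<in>Basis. frechet_derivative (\<lambda>y. frechet_derivative f (at y) b) (at x) b)"

definition harmonic_on :: "'a::euclidean_space set \<Rightarrow> ('a \<Rightarrow> real) \<Rightarrow> bool" where
  "harmonic_on S f \<longleftrightarrow> Ck_on 2 S f \<and> (\<forall>x\<in>S. laplacian f x = 0)"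

text \<open>For open sets \<open>A\<close> and \<open>B\<close>.\<close>

definition diffeomorphism ::
  "'a::euclidean_space set \<Rightarrow> 'b::euclidean_space set \<Rightarrow> ('a \<Rightarrow> 'b) \<Rightarrow> bool" where
  "diffeomorphism A B F \<longleftrightarrow>
     bij_betw F A B \<and> smooth_on A F \<and> smooth_on B (inv_into A F)"

subsection \<open>Generalized barycentric coordinates\<close>

text \<open>Vertices and coordinate functions are indexed from \<open>0\<close>; the values of the coordinate
  functions outside \<open>V\<close> are irrelevant.\<close>

definition linear_on_segment :: "complex \<Rightarrow> complex \<Rightarrow> (complex \<Rightarrow> real) \<Rightarrow> bool" where
  "linear_on_segment a b f \<longleftrightarrow>
     (\<forall>t\<in>{0..1}. f ((1 - t) *\<^sub>R a + t *\<^sub>R b) = (1 - t) * f a + t * f b)"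

definition gbc_functions ::
  "complex set \<Rightarrow> complex list \<Rightarrow> (nat \<Rightarrow> complex \<Rightarrow> real) \<Rightarrow> bool" where
  "gbc_functions V vs \<phi> \<longleftrightarrow>
     (\<forall>x\<in>V. (\<Sum>i<length vs. \<phi> i x) = 1) \<and>
     (\<forall>x\<in>V. (\<Sum>i<length vs. \<phi> i x *\<^sub>R vs ! i) = x) \<and>
     (\<forall>x\<in>V. \<forall>i<length vs. 0 \<le> \<phi> i x) \<and>
     (\<forall>i<length vs. \<forall>j<length vs.
        linear_on_segment (vs ! j) (vs ! (Suc j mod length vs)) (\<phi> i)) \<and>
     (\<forall>i<length vs. \<forall>j<length vs. \<phi> i (vs ! j) = (if i = j then 1 else 0))"

definition harmonic_gbc_functions ::
  "complex set \<Rightarrow> complex list \<Rightarrow> (nat \<Rightarrow> complex \<Rightarrow> real) \<Rightarrow> bool" where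
  "harmonic_gbc_functions V vs \<phi> \<longleftrightarrow>
     gbc_functions V vs \<phi> \<and>
     (\<forall>i<length vs. continuous_on V (\<phi> i) \<and> harmonic_on (interior V) (\<phi> i))"

end

theory Submission
  imports Defs
begin

text \<open>The theorem is an instance of the Rado-Kneser-Choquet theorem: a harmonic map of a Jordan domain
  that restricts to a homeomorphism of the boundary onto the boundary of a convex region is a
  diffeomorphism of the interiors. Write \<open>F\<close> for the map. It is continuous on \<open>V\<close>, it is harmonic
  inside, and since the coordinate functions are linear on the edges, it carries the closed
  polygonal path through \<open>vs\<close> to the one through \<open>ws\<close> with the same parameter
  (\<open>gbc_boundary_map\<close>).

  Every coordinate \<open>h z = d \<bullet> (F z - c)\<close> of \<open>F\<close> is harmonic, that is, \<open>dh = Re (f dz)\<close> with \<open>f\<close>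
  holomorphic. By the maximum principle, applied to the coordinate normal to a supporting line of
  \<open>W\<close>, interior points are sent to interior points. The crucial point is that the Jacobian does not
  vanish. If it vanished at \<open>a\<close>, then for some direction \<open>d\<close> the function \<open>h z = d \<bullet> (F z - F a)\<close>
  would have a critical zero at \<open>a\<close>. There \<open>h\<close> is the real part of a holomorphic function with a
  zero of order at least two, so at least four sectors in which \<open>h\<close> is alternately positive and
  negative meet at \<open>a\<close> (\<open>critical_point_rays\<close>). On the other hand, a line through an interior point
  of the convex set \<open>W\<close> cuts its boundary into two connected parts
  (\<open>connected_boundary_halfplane\<close>). So the sets of boundary points of \<open>V\<close> with \<open>h > 0\<close> and with
  \<open>h < 0\<close> are connected, and by the maximum principle the sets \<open>{h > 0}\<close> and \<open>{h < 0}\<close> in \<open>V\<close> are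
  connected as well (\<open>connected_superlevel\<close>). By the Jordan curve theorem two disjoint connected sets
  cannot be entered alternately along four rays from \<open>a\<close> (\<open>alternating_rays\<close>), a contradiction.

  Hence \<open>F\<close> is a proper local homeomorphism from the connected interior of \<open>V\<close> to the convex interior
  of \<open>W\<close>. Such a map is a covering, and the covering has a section because a convex set is simply
  connected; this makes \<open>F\<close> bijective (\<open>proper_local_homeomorphism_bij\<close>). Smoothness of the inverse
  follows from Cramer's rule by bootstrapping.\<close>

section \<open>Calculus of continuously differentiable functions\<close>

text \<open>Congruence is a hypothesis of this rule because the inductive proof of congruence itself
  needs the rule.\<close>

lemma Ck_on_SucI:
  fixes f :: "'a::euclidean_space \<Rightarrow> 'b::real_normed_vector"
  assumes "open S" "\<And>x. x \<in> S \<Longrightarrow> (f has_derivative f' x) (at x)"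
    and "\<And>v. Ck_on k S (\<lambda>x. f' x v)"
    and cong: "\<And>g h :: 'a::euclidean_space \<Rightarrow> 'b::real_normed_vector.
      Ck_on k S g \<Longrightarrow> (\<And>x. x \<in> S \<Longrightarrow> g x = h x) \<Longrightarrow> Ck_on k S h"
  shows "Ck_on (Suc k) S f"
proof -
  have "frechet_derivative f (at x) = f' x" if "x \<in> S" for x
    using assms(2)[OF that] frechet_derivative_at by metis
  then have "Ck_on k S (\<lambda>x. frechet_derivative f (at x) v)" for v
    by (intro cong[OF assms(3)[of v]]) simp
  moreover have "f differentiable at x" if "x \<in> S" for x
    using assms(2)[OF that] by (auto simp: differentiable_def)
  ultimately show ?thesis
    by simp
qed

lemma Ck_on_cong:
  assumes "open S" "Ck_on k S f" "\<And>x. x \<in> S \<Longrightarrow> f x = g x"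
  shows "Ck_on k S g"
  using assms(2,3)
proof (induction k arbitrary: f g)
  case 0
  then show ?case
    using continuous_on_eq by fastforce
next
  case (Suc k)
  have "(g has_derivative frechet_derivative f (at x)) (at x)" if "x \<in> S" for x
    using Suc.prems that \<open>open S\<close>
    by (intro has_derivative_transform_within_open[of f _ x UNIV S g])
      (auto simp: frechet_derivative_works)
  moreover have "Ck_on k S (\<lambda>x. frechet_derivative f (at x) v)" for v
    using Suc.prems by simp
  ultimately show ?case
    using Suc.IH by (rule Ck_on_SucI[OF \<open>open S\<close>])
qed

lemma Ck_on_has_derivativeI:
  fixes f :: "'a::euclidean_space \<Rightarrow> 'b::real_normed_vector"
  assumes "open S" "\<And>x. x \<in> S \<Longrightarrow> (f has_derivative f' x) (at x)"
    and "\<And>v. Ck_on k S (\<lambda>x. f' x v)"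
  shows "Ck_on (Suc k) S f"
  using assms(2,3) Ck_on_cong[OF \<open>open S\<close>] by (rule Ck_on_SucI[OF \<open>open S\<close>])

lemma Ck_on_has_derivative:
  assumes "Ck_on (Suc k) S f" "x \<in> S"
  shows "(f has_derivative frechet_derivative f (at x)) (at x)"
  using assms by (simp add: frechet_derivative_works)

lemma Ck_on_SucD: "Ck_on (Suc k) S f \<Longrightarrow> Ck_on k S f"
proof (induction k arbitrary: f)
  case 0
  then show ?case
    by (auto intro!: continuous_at_imp_continuous_on differentiable_imp_continuous_within)
qed simp

lemma Ck_on_const: "Ck_on k S (\<lambda>x. c)"
  by (induction k arbitrary: c) auto

lemma Ck_on_bounded_linear:
  assumes "bounded_linear L" "open S" "Ck_on k S f"
  shows "Ck_on k S (\<lambda>x. L (f x))"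
  using assms(3)
proof (induction k arbitrary: f)
  case 0
  then show ?case
    by (auto intro: bounded_linear.continuous_on[OF assms(1)])
next
  case (Suc k)
  show ?case
    using Suc assms Ck_on_has_derivative[OF Suc.prems]
    by (intro Ck_on_has_derivativeI[where f' = "\<lambda>x v. L (frechet_derivative f (at x) v)"]
        bounded_linear.has_derivative[OF assms(1)]) auto
qed

lemma Ck_on_add:
  assumes "open S" "Ck_on k S f" "Ck_on k S g"
  shows "Ck_on k S (\<lambda>x. f x + g x)"
  using assms(2,3)
proof (induction k arbitrary: f g)
  case 0
  then show ?case
    by (simp add: continuous_on_add)
next
  case (Suc k)
  show ?case
    using Suc assms Ck_on_has_derivative[OF Suc.prems(1)] Ck_on_has_derivative[OF Suc.prems(2)]
    by (intro Ck_on_has_derivativeI[where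
        f' = "\<lambda>x v. frechet_derivative f (at x) v + frechet_derivative g (at x) v"]
        has_derivative_add) auto
qed

lemma Ck_on_sum:
  assumes "open S" "\<And>i. i \<in> I \<Longrightarrow> Ck_on k S (f i)"
  shows "Ck_on k S (\<lambda>x. \<Sum>i\<in>I. f i x)"
  using assms(2)
  by (induction I rule: infinite_finite_induct) (auto intro: Ck_on_const Ck_on_add[OF assms(1)])

lemma Ck_on_bilinear:
  assumes "bounded_bilinear B" "open S" "Ck_on k S f" "Ck_on k S g"
  shows "Ck_on k S (\<lambda>x. B (f x) (g x))"
  using assms(3,4)
proof (induction k arbitrary: f g)
  case 0
  then show ?case
    by (auto intro: bounded_bilinear.continuous_on[OF assms(1)])
next
  case (Suc k)
  note fg = Suc.prems
  show ?case
    using Suc.IH[OF Ck_on_SucD[OF fg(1)]] Suc.IH[OF _ Ck_on_SucD[OF fg(2)]] assms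
      Ck_on_has_derivative[OF fg(1)] Ck_on_has_derivative[OF fg(2)] fg
    by (intro Ck_on_has_derivativeI[where
        f' = "\<lambda>x v. B (f x) (frechet_derivative g (at x) v) + B (frechet_derivative f (at x) v) (g x)"]
        bounded_bilinear.FDERIV[OF assms(1)] Ck_on_add) auto
qed

lemma Ck_on_compose:
  fixes G :: "'a::euclidean_space \<Rightarrow> 'b::euclidean_space" and R :: "'b \<Rightarrow> 'c::real_normed_vector"
  assumes "open S" "open T" "G ` T \<subseteq> S" "Ck_on k S R" "Ck_on k T G"
  shows "Ck_on k T (\<lambda>y. R (G y))"
  using assms(4,5)
proof (induction k arbitrary: R)
  case 0
  then show ?case
    using assms(3) by (auto intro: continuous_on_compose2)
next
  case (Suc k)
  let ?R' = "\<lambda>x. frechet_derivative R (at x)" and ?G' = "\<lambda>y. frechet_derivative G (at y)"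
  have der: "((\<lambda>y. R (G y)) has_derivative (\<lambda>v. \<Sum>b\<in>Basis. (?G' y v \<bullet> b) *\<^sub>R ?R' (G y) b)) (at y)"
    if "y \<in> T" for y
  proof -
    have R: "(R has_derivative ?R' (G y)) (at (G y))"
      using Ck_on_has_derivative[OF Suc.prems(1)] assms(3) that by blast
    have 1: "((\<lambda>y. R (G y)) has_derivative (\<lambda>v. ?R' (G y) (?G' y v))) (at y)"
      using Ck_on_has_derivative[OF Suc.prems(2) that] R by (rule has_derivative_compose)
    have 2: "?R' (G y) w = (\<Sum>b\<in>Basis. (w \<bullet> b) *\<^sub>R ?R' (G y) b)" for w
    proof -
      have "linear (?R' (G y))"
        using R by (rule has_derivative_linear)
      then have "?R' (G y) (\<Sum>b\<in>Basis. (w \<bullet> b) *\<^sub>R b) = (\<Sum>b\<in>Basis. (w \<bullet> b) *\<^sub>R ?R' (G y) b)"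
        by (simp add: linear_sum linear_cmul)
      then show ?thesis
        by (simp add: euclidean_representation)
    qed
    show ?thesis
      using 1 unfolding 2[symmetric] .
  qed
  show ?case
  proof (rule Ck_on_has_derivativeI[OF assms(2) der])
    show "Ck_on k T (\<lambda>y. \<Sum>b\<in>Basis. (?G' y v \<bullet> b) *\<^sub>R ?R' (G y) b)" for v
      using Suc.prems Suc.IH Ck_on_SucD[OF Suc.prems(2)]
      by (intro Ck_on_sum Ck_on_bilinear[OF bounded_bilinear_scaleR]
          Ck_on_bounded_linear[OF bounded_linear_inner_left] assms(2)) auto
  qed
qed

lemma Ck_on_inverse:
  fixes f :: "'a::euclidean_space \<Rightarrow> real"
  assumes "open S" "Ck_on k S f" "\<And>x. x \<in> S \<Longrightarrow> f x \<noteq> 0"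
  shows "Ck_on k S (\<lambda>x. inverse (f x))"
  using assms(2)
proof (induction k)
  case 0
  then show ?case
    using assms(3) by (simp add: continuous_on_inverse)
next
  case (Suc k)
  let ?f' = "\<lambda>x. frechet_derivative f (at x)"
  note IH = Suc.IH[OF Ck_on_SucD[OF Suc.prems]]
  show ?case
  proof (rule Ck_on_has_derivativeI[OF assms(1)])
    show "((\<lambda>x. inverse (f x)) has_derivative (\<lambda>v. - (inverse (f x) * ?f' x v * inverse (f x)))) (at x)"
      if "x \<in> S" for x
      using Ck_on_has_derivative[OF Suc.prems that] assms(3)[OF that]
      by (intro Deriv.has_derivative_inverse)
    show "Ck_on k S (\<lambda>x. - (inverse (f x) * ?f' x v * inverse (f x)))" for v
      using Suc.prems IH
      by (intro Ck_on_bounded_linear[OF bounded_linear_minus[OF bounded_linear_ident]]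
          Ck_on_bilinear[OF bounded_bilinear_mult] assms(1)) auto
  qed
qed

text \<open>The real derivative of \<open>f\<close> in direction \<open>v\<close> is again a holomorphic function, \<open>deriv f * v\<close>.\<close>

lemma holomorphic_Ck_on:
  assumes "open S" "f holomorphic_on S"
  shows "Ck_on k S f"
  using assms(2)
proof (induction k arbitrary: f)
  case 0
  then show ?case
    by (simp add: holomorphic_on_imp_continuous_on)
next
  case (Suc k)
  show ?case
  proof (rule Ck_on_has_derivativeI[OF assms(1)])
    show "(f has_derivative (\<lambda>v. deriv f x * v)) (at x)" if "x \<in> S" for x
      using holomorphic_derivI[OF Suc.prems assms(1) that] by (simp add: has_field_derivative_def)
    show "Ck_on k S (\<lambda>x. deriv f x * v)" for v
      using Suc.prems assms(1) by (intro Suc.IH holomorphic_intros) auto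
  qed
qed

section \<open>Harmonic functions in the plane\<close>

lemma has_real_derivative_along_line:
  assumes "(g has_derivative D) (at (p + s *\<^sub>R a))"
  shows "((\<lambda>s. g (p + s *\<^sub>R a)) has_real_derivative D a) (at s)"
proof -
  have "((\<lambda>s. p + s *\<^sub>R a) has_derivative (\<lambda>s. s *\<^sub>R a)) (at s)"
    by (auto intro!: derivative_eq_intros)
  then have "((\<lambda>s. g (p + s *\<^sub>R a)) has_derivative (\<lambda>s. D (s *\<^sub>R a))) (at s)"
    using assms by (rule has_derivative_compose)
  moreover have "D (s *\<^sub>R a) = D a * s" for s
    using linear_cmul[OF has_derivative_linear[OF assms]] by simp
  ultimately show ?thesis
    by (simp add: has_field_derivative_def)
qed

text \<open>The second difference of \<open>f\<close> over a parallelogram is a value of the mixed second derivative;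
  the difference does not depend on the order of the two directions.\<close>

lemma second_difference_mean_value:
  fixes f :: "'a::euclidean_space \<Rightarrow> real"
  assumes "0 < t" "Ck_on 2 S f"
    and inS: "\<And>s u. \<lbrakk>0 \<le> s; s \<le> t; 0 \<le> u; u \<le> t\<rbrakk> \<Longrightarrow> z + s *\<^sub>R a + u *\<^sub>R b \<in> S"
  obtains s u where "0 < s" "s < t" "0 < u" "u < t"
    "f (z + t *\<^sub>R a + t *\<^sub>R b) - f (z + t *\<^sub>R a) - f (z + t *\<^sub>R b) + f z =
      t * t * frechet_derivative (\<lambda>y. frechet_derivative f (at y) a) (at (z + s *\<^sub>R a + u *\<^sub>R b)) b"
proof -
  let ?D = "\<lambda>y. frechet_derivative f (at y)"
  have C1: "Ck_on (Suc (Suc 0)) S f"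
    using assms(2) by (simp add: numeral_2_eq_2)
  have C2: "Ck_on (Suc 0) S (\<lambda>y. ?D y a)"
    using C1 by simp
  have der: "((\<lambda>s. f (z + s *\<^sub>R a + t *\<^sub>R b) - f (z + s *\<^sub>R a)) has_real_derivative
      ?D (z + s *\<^sub>R a + t *\<^sub>R b) a - ?D (z + s *\<^sub>R a) a) (at s)" if "0 \<le> s" "s \<le> t" for s
  proof (rule DERIV_diff)
    have "(f has_derivative ?D (z + s *\<^sub>R a)) (at (z + s *\<^sub>R a))"
      using inS[of s 0] that \<open>0 < t\<close> by (intro Ck_on_has_derivative[OF C1]) simp
    then show "((\<lambda>s. f (z + s *\<^sub>R a)) has_real_derivative ?D (z + s *\<^sub>R a) a) (at s)"
      by (rule has_real_derivative_along_line)
    have "(f has_derivative ?D ((z + t *\<^sub>R b) + s *\<^sub>R a)) (at ((z + t *\<^sub>R b) + s *\<^sub>R a))"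
      using inS[of s t] that \<open>0 < t\<close> by (intro Ck_on_has_derivative[OF C1]) (simp add: algebra_simps)
    from has_real_derivative_along_line[OF this]
    show "((\<lambda>s. f (z + s *\<^sub>R a + t *\<^sub>R b)) has_real_derivative ?D (z + s *\<^sub>R a + t *\<^sub>R b) a) (at s)"
      by (simp add: algebra_simps)
  qed
  obtain s where s: "0 < s" "s < t" and
    1: "(f (z + t *\<^sub>R a + t *\<^sub>R b) - f (z + t *\<^sub>R a)) - (f (z + 0 *\<^sub>R a + t *\<^sub>R b) - f (z + 0 *\<^sub>R a))
      = (t - 0) * (?D (z + s *\<^sub>R a + t *\<^sub>R b) a - ?D (z + s *\<^sub>R a) a)"
    using MVT2[OF \<open>0 < t\<close> der] by blast
  have der2: "((\<lambda>u. ?D (z + s *\<^sub>R a + u *\<^sub>R b) a) has_real_derivative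
      frechet_derivative (\<lambda>y. ?D y a) (at (z + s *\<^sub>R a + u *\<^sub>R b)) b) (at u)"
    if "0 \<le> u" "u \<le> t" for u
    using inS[of s u] that s
    by (intro has_real_derivative_along_line Ck_on_has_derivative[OF C2]) auto
  obtain u where u: "0 < u" "u < t" and
    2: "?D (z + s *\<^sub>R a + t *\<^sub>R b) a - ?D (z + s *\<^sub>R a + 0 *\<^sub>R b) a
      = (t - 0) * frechet_derivative (\<lambda>y. ?D y a) (at (z + s *\<^sub>R a + u *\<^sub>R b)) b"
    using MVT2[OF \<open>0 < t\<close> der2] by blast
  show thesis
    using s u 1 2 by (intro that[of s u]) (auto simp: algebra_simps)
qed

lemma second_derivative_symmetric:
  fixes f :: "'a::euclidean_space \<Rightarrow> real"
  assumes "open S" "z \<in> S" "Ck_on 2 S f"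
  shows "frechet_derivative (\<lambda>y. frechet_derivative f (at y) a) (at z) b =
         frechet_derivative (\<lambda>y. frechet_derivative f (at y) b) (at z) a"
proof (rule ccontr)
  define P where "P = (\<lambda>a b x. frechet_derivative (\<lambda>y. frechet_derivative f (at y) a) (at x) b)"
  assume "\<not> ?thesis"
  then have ne: "\<bar>P a b z - P b a z\<bar> > 0"
    by (simp add: P_def)
  have cont: "continuous_on S (P a b)" for a b
    using assms(3) by (simp add: P_def numeral_2_eq_2)
  define e where "e = \<bar>P a b z - P b a z\<bar> / 2"
  have "e > 0"
    using ne by (simp add: e_def)
  have near: "\<exists>d>0. \<forall>x. dist x z < d \<longrightarrow> x \<in> S \<and> \<bar>P a b x - P a b z\<bar> < e" for a b
  proof -
    obtain d1 where d1: "d1 > 0" "ball z d1 \<subseteq> S"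
      using assms openE by blast
    obtain d2 where "d2 > 0" "\<forall>x\<in>S. dist x z < d2 \<longrightarrow> dist (P a b x) (P a b z) < e"
      using cont[of a b] \<open>e > 0\<close> assms(2) unfolding continuous_on_iff by blast
    then show ?thesis
      using d1 by (intro exI[of _ "min d1 d2"]) (auto simp: dist_real_def dist_commute mem_ball subset_iff)
  qed
  obtain d1 where d1: "d1 > 0" "\<And>x. dist x z < d1 \<Longrightarrow> x \<in> S \<and> \<bar>P a b x - P a b z\<bar> < e"
    using near[of a b] by blast
  obtain d2 where d2: "d2 > 0" "\<And>x. dist x z < d2 \<Longrightarrow> x \<in> S \<and> \<bar>P b a x - P b a z\<bar> < e"
    using near[of b a] by blast
  define t where "t = min d1 d2 / (norm a + norm b + 1)"
  have pos: "0 < norm a + norm b + 1"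
    using norm_ge_zero[of a] norm_ge_zero[of b] by linarith
  have "t > 0"
    using d1(1) d2(1) pos by (simp add: t_def)
  have close: "dist (z + s *\<^sub>R a + u *\<^sub>R b) z < min d1 d2" if "0 \<le> s" "s \<le> t" "0 \<le> u" "u \<le> t" for s u
  proof -
    have "dist (z + s *\<^sub>R a + u *\<^sub>R b) z = norm (s *\<^sub>R a + u *\<^sub>R b)"
      by (simp add: dist_norm)
    also have "\<dots> \<le> norm (s *\<^sub>R a) + norm (u *\<^sub>R b)"
      by (rule norm_triangle_ineq)
    also have "\<dots> = s * norm a + u * norm b"
      using that by simp
    also have "\<dots> \<le> t * norm a + t * norm b"
      using that by (intro add_mono mult_right_mono) auto
    also have "\<dots> < t * (norm a + norm b + 1)"
      using \<open>t > 0\<close> by (simp add: algebra_simps)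
    also have "\<dots> = min d1 d2"
      using pos by (simp add: t_def)
    finally show ?thesis .
  qed
  obtain s u where 1: "0 < s" "s < t" "0 < u" "u < t"
    "f (z + t *\<^sub>R a + t *\<^sub>R b) - f (z + t *\<^sub>R a) - f (z + t *\<^sub>R b) + f z =
      t * t * P a b (z + s *\<^sub>R a + u *\<^sub>R b)"
    unfolding P_def
    by (rule second_difference_mean_value[OF \<open>t > 0\<close> assms(3), of z a b])
      (use close d1 in auto)
  obtain s' u' where 2: "0 < s'" "s' < t" "0 < u'" "u' < t"
    "f (z + t *\<^sub>R b + t *\<^sub>R a) - f (z + t *\<^sub>R b) - f (z + t *\<^sub>R a) + f z =
      t * t * P b a (z + s' *\<^sub>R b + u' *\<^sub>R a)"
    unfolding P_def
  proof (rule second_difference_mean_value[OF \<open>t > 0\<close> assms(3), of z b a])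
    show "z + s *\<^sub>R b + u *\<^sub>R a \<in> S" if "0 \<le> s" "s \<le> t" "0 \<le> u" "u \<le> t" for s u
      using close[of u s] d1(2)[of "z + s *\<^sub>R b + u *\<^sub>R a"] that by (simp add: algebra_simps)
  qed
  have "t * t * P a b (z + s *\<^sub>R a + u *\<^sub>R b) = t * t * P b a (z + s' *\<^sub>R b + u' *\<^sub>R a)"
    using 1(5) 2(5) by (simp add: algebra_simps)
  then have "P a b (z + s *\<^sub>R a + u *\<^sub>R b) = P b a (z + u' *\<^sub>R a + s' *\<^sub>R b)"
    using \<open>t > 0\<close> by (simp add: algebra_simps)
  moreover have "\<bar>P a b (z + s *\<^sub>R a + u *\<^sub>R b) - P a b z\<bar> < e"
    using close[of s u] 1 by (intro d1(2)[THEN conjunct2]) auto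
  moreover have "\<bar>P b a (z + u' *\<^sub>R a + s' *\<^sub>R b) - P b a z\<bar> < e"
    using close[of u' s'] 2 by (intro d2(2)[THEN conjunct2]) auto
  ultimately show False
    unfolding e_def by (simp add: abs_if field_simps split: if_splits)
qed

text \<open>The complex form of the gradient of a harmonic function: \<open>f = h\<^sub>x - i h\<^sub>y\<close>, so that
  \<open>dh = Re (f dz)\<close>. All properties of harmonic functions used below are derived from the
  existence of a holomorphic \<open>f\<close>, which is visibly inherited by real linear combinations.\<close>

definition holomorphic_gradient ::
  "complex set \<Rightarrow> (complex \<Rightarrow> real) \<Rightarrow> (complex \<Rightarrow> complex) \<Rightarrow> bool" where
  "holomorphic_gradient S h f \<longleftrightarrow>
     f holomorphic_on S \<and> (\<forall>z\<in>S. (h has_derivative (\<lambda>v. Re (f z * v))) (at z))"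

lemma holomorphic_gradient_subset:
  "holomorphic_gradient S h f \<Longrightarrow> T \<subseteq> S \<Longrightarrow> holomorphic_gradient T h f"
  unfolding holomorphic_gradient_def using holomorphic_on_subset by blast

lemma linear_complex_expansion:
  fixes D :: "complex \<Rightarrow> 'a::real_vector"
  assumes "linear D"
  shows "D v = Re v *\<^sub>R D 1 + Im v *\<^sub>R D \<i>"
proof -
  have "D (Re v *\<^sub>R 1 + Im v *\<^sub>R \<i>) = Re v *\<^sub>R D 1 + Im v *\<^sub>R D \<i>"
    using assms by (simp only: linear_add linear_cmul)
  moreover have "Re v *\<^sub>R 1 + Im v *\<^sub>R \<i> = v"
    by (simp add: complex_eq_iff)
  ultimately show ?thesis
    by simp
qed

text \<open>The Cauchy-Riemann equations for \<open>h\<^sub>x - i h\<^sub>y\<close> are the symmetry of the second derivatives and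
  the Laplace equation.\<close>

lemma harmonic_on_imp_holomorphic_gradient:
  assumes "open S" "harmonic_on S h"
  shows "holomorphic_gradient S h
    (\<lambda>z. of_real (frechet_derivative h (at z) 1) - \<i> * of_real (frechet_derivative h (at z) \<i>))"
    (is "holomorphic_gradient S h ?f")
  unfolding holomorphic_gradient_def
proof (intro conjI ballI)
  let ?D = "\<lambda>z. frechet_derivative h (at z)"
  have C: "Ck_on (Suc (Suc 0)) S h"
    using assms(2) by (simp add: harmonic_on_def numeral_2_eq_2)
  show "(h has_derivative (\<lambda>v. Re (?f z * v))) (at z)" if "z \<in> S" for z
  proof -
    have D: "(h has_derivative ?D z) (at z)"
      using Ck_on_has_derivative[OF C that] .
    moreover have "?D z = (\<lambda>v. Re (?f z * v))"
      by (rule ext, subst linear_complex_expansion[OF has_derivative_linear[OF D]]) simp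
    ultimately show ?thesis
      by simp
  qed
  show "?f holomorphic_on S"
  proof (rule holomorphic_onI)
    fix z assume "z \<in> S"
    define D1 where "D1 = frechet_derivative (\<lambda>y. ?D y 1) (at z)"
    define D2 where "D2 = frechet_derivative (\<lambda>y. ?D y \<i>) (at z)"
    have D1: "((\<lambda>y. ?D y 1) has_derivative D1) (at z)"
      unfolding D1_def by (rule Ck_on_has_derivative[OF _ \<open>z \<in> S\<close>, where k = 0]) (use C in simp)
    have D2: "((\<lambda>y. ?D y \<i>) has_derivative D2) (at z)"
      unfolding D2_def by (rule Ck_on_has_derivative[OF _ \<open>z \<in> S\<close>, where k = 0]) (use C in simp)
    have sym: "D1 \<i> = D2 1"
      unfolding D1_def D2_def using assms \<open>z \<in> S\<close>
      by (intro second_derivative_symmetric) (auto simp: harmonic_on_def)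
    have lap: "D2 \<i> = - D1 1"
      using assms(2) \<open>z \<in> S\<close>
      by (simp add: eq_neg_iff_add_eq_0 add.commute)
        (simp add: harmonic_on_def laplacian_def Basis_complex_def D1_def D2_def)
    have "(?f has_derivative (\<lambda>v. of_real (D1 v) - \<i> * of_real (D2 v))) (at z)"
      by (intro has_derivative_diff has_derivative_mult_right has_derivative_of_real D1 D2)
    moreover have "(\<lambda>v. of_real (D1 v) - \<i> * of_real (D2 v)) =
        (\<lambda>v. (of_real (D1 1) - \<i> * of_real (D2 1)) * v)"
      proof
      fix v
      show "of_real (D1 v) - \<i> * of_real (D2 v) = (of_real (D1 1) - \<i> * of_real (D2 1)) * v"
        using sym lap linear_complex_expansion[OF has_derivative_linear[OF D1], of v]
          linear_complex_expansion[OF has_derivative_linear[OF D2], of v]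
        by (simp add: complex_eq_iff)
    qed
    ultimately have "(?f has_field_derivative (of_real (D1 1) - \<i> * of_real (D2 1))) (at z)"
      unfolding has_field_derivative_def by simp
    then show "?f field_differentiable at z within S"
      using field_differentiable_at_within field_differentiable_def by blast
  qed
qed

lemma holomorphic_gradient_linear_combination:
  assumes "\<And>i. i \<in> I \<Longrightarrow> holomorphic_gradient S (h i) (f i)"
  shows "holomorphic_gradient S (\<lambda>z. (\<Sum>i\<in>I. h i z * c i) + d) (\<lambda>z. \<Sum>i\<in>I. of_real (c i) * f i z)"
  unfolding holomorphic_gradient_def
proof (intro conjI ballI)
  show "(\<lambda>z. \<Sum>i\<in>I. of_real (c i) * f i z) holomorphic_on S"
    using assms by (auto simp: holomorphic_gradient_def intro!: holomorphic_intros)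
  fix z assume "z \<in> S"
  have "((\<lambda>z. (\<Sum>i\<in>I. h i z * c i) + d) has_derivative (\<lambda>v. (\<Sum>i\<in>I. Re (f i z * v) * c i) + 0)) (at z)"
    using assms \<open>z \<in> S\<close> unfolding holomorphic_gradient_def
    by (intro has_derivative_add has_derivative_sum has_derivative_mult_left has_derivative_const) auto
  then show "((\<lambda>z. (\<Sum>i\<in>I. h i z * c i) + d) has_derivative
      (\<lambda>v. Re ((\<Sum>i\<in>I. of_real (c i) * f i z) * v))) (at z)"
    by (simp add: sum_distrib_right mult.assoc mult.commute[of "c _"])
qed

lemma holomorphic_gradient_Ck_on:
  assumes "open S" "holomorphic_gradient S h f"
  shows "Ck_on k S h"
proof (rule Ck_on_SucD, rule Ck_on_has_derivativeI[OF assms(1)])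
  show "(h has_derivative (\<lambda>v. Re (f z * v))) (at z)" if "z \<in> S" for z
    using assms(2) that by (simp add: holomorphic_gradient_def)
  show "Ck_on k S (\<lambda>z. Re (f z * v))" for v
    using assms by (intro Ck_on_bounded_linear[OF bounded_linear_Re] holomorphic_Ck_on)
      (auto simp: holomorphic_gradient_def intro!: holomorphic_intros)
qed

lemma holomorphic_gradient_primitive:
  assumes "holomorphic_gradient (ball a r) h f" "0 < r"
  obtains g where "\<And>z. z \<in> ball a r \<Longrightarrow> (g has_field_derivative f z) (at z)"
    "\<And>z. z \<in> ball a r \<Longrightarrow> Re (g z) = h z - h a" "g a = 0"
proof -
  have hol: "f holomorphic_on ball a r"
    and der: "\<And>z. z \<in> ball a r \<Longrightarrow> (h has_derivative (\<lambda>v. Re (f z * v))) (at z)"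
    using assms(1) by (auto simp: holomorphic_gradient_def)
  obtain g where g: "\<And>z. z \<in> ball a r \<Longrightarrow> (g has_field_derivative f z) (at z within ball a r)"
    using holomorphic_convex_primitive'[OF convex_ball open_ball hol] by blast
  have g': "(g has_field_derivative f z) (at z)" if "z \<in> ball a r" for z
    using g[OF that] by (simp add: at_within_open[OF that open_ball])
  have "((\<lambda>z. Re (g z) - h z) has_derivative (\<lambda>v. 0)) (at z within ball a r)" if "z \<in> ball a r" for z
  proof (rule has_derivative_at_withinI)
    have "((\<lambda>z. Re (g z) - h z) has_derivative (\<lambda>v. Re (f z * v) - Re (f z * v))) (at z)"
      using g'[OF that] der[OF that] unfolding has_field_derivative_def
      by (intro has_derivative_diff has_derivative_Re)
    then show "((\<lambda>z. Re (g z) - h z) has_derivative (\<lambda>v. 0)) (at z)"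
      by simp
  qed
  then obtain c where c: "\<And>z. z \<in> ball a r \<Longrightarrow> Re (g z) - h z = c"
    using has_derivative_zero_constant[OF convex_ball, of a r "\<lambda>z. Re (g z) - h z"] by auto
  show thesis
  proof
    show "((\<lambda>z. g z - g a) has_field_derivative f z) (at z)" if "z \<in> ball a r" for z
      using g'[OF that] by (auto intro!: derivative_eq_intros)
    show "Re (g z - g a) = h z - h a" if "z \<in> ball a r" for z
      using c[OF that] c[of a] \<open>0 < r\<close> by simp
  qed simp
qed

lemma holomorphic_gradient_continuous_on:
  "holomorphic_gradient S h f \<Longrightarrow> continuous_on S h"
proof (rule continuous_at_imp_continuous_on, rule ballI)
  fix z assume "holomorphic_gradient S h f" "z \<in> S"
  then have "(h has_derivative (\<lambda>v. Re (f z * v))) (at z)"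
    by (simp add: holomorphic_gradient_def)
  then show "isCont h z"
    by (rule has_derivative_continuous)
qed

text \<open>The strong maximum principle, from the maximum modulus principle for \<open>exp g\<close>, where \<open>g\<close> is
  a local primitive of the holomorphic gradient.\<close>

lemma harmonic_local_maximum:
  assumes "open S" "holomorphic_gradient S h f" "a \<in> S" "\<And>z. z \<in> S \<Longrightarrow> h z \<le> h a"
  obtains r where "0 < r" "ball a r \<subseteq> S" "\<And>z. z \<in> ball a r \<Longrightarrow> h z = h a"
proof -
  obtain r where r: "0 < r" "ball a r \<subseteq> S"
    using assms openE by blast
  obtain g where g: "\<And>z. z \<in> ball a r \<Longrightarrow> (g has_field_derivative f z) (at z)"
    "\<And>z. z \<in> ball a r \<Longrightarrow> Re (g z) = h z - h a" "g a = 0"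
    using holomorphic_gradient_primitive[OF holomorphic_gradient_subset[OF assms(2) r(2)] r(1)] by blast
  have "g holomorphic_on ball a r"
    unfolding holomorphic_on_open[OF open_ball] using g(1) by blast
  then have hol: "(\<lambda>z. exp (g z)) holomorphic_on ball a r"
    by (intro holomorphic_intros)
  have "(\<lambda>z. exp (g z)) constant_on ball a r"
    by (rule maximum_modulus_principle[OF hol open_ball connected_ball open_ball subset_refl, of a])
      (use r g assms(4) in auto)
  then have "exp (g z) = exp (g a)" if "z \<in> ball a r" for z
    using that r(1) unfolding constant_on_def by force
  then have "exp (Re (g z)) = exp (Re (g a))" if "z \<in> ball a r" for z
    using that by (metis norm_exp_eq_Re)
  then have "h z = h a" if "z \<in> ball a r" for z
    using that g by simp
  then show thesis
    using r that by blast
qed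

lemma harmonic_maximum_principle:
  assumes "open S" "connected S" "holomorphic_gradient S h f" "a \<in> S"
    and max: "\<And>z. z \<in> S \<Longrightarrow> h z \<le> h a" and "z \<in> S"
  shows "h z = h a"
proof -
  let ?A = "{z\<in>S. h z = h a}"
  have "open ?A"
    unfolding open_contains_ball
  proof
    fix b assume b: "b \<in> ?A"
    obtain r where r: "0 < r" "ball b r \<subseteq> S" "\<And>z. z \<in> ball b r \<Longrightarrow> h z = h b"
      using harmonic_local_maximum[OF assms(1,3), of b] b max by auto
    have "ball b r \<subseteq> ?A"
    proof
      show "z \<in> ?A" if "z \<in> ball b r" for z
        using r(2) r(3)[OF that] that b by (simp add: subset_iff)
    qed
    then show "\<exists>e>0. ball b e \<subseteq> ?A"
      using r(1) by blast
  qed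
  then have "openin (top_of_set S) ?A"
    by (intro open_subset) auto
  moreover have "closedin (top_of_set S) ?A"
    using continuous_closedin_preimage_constant[OF holomorphic_gradient_continuous_on[OF assms(3)]] .
  ultimately have "?A = S"
    using assms(2,4) unfolding connected_clopen by blast
  then show ?thesis
    using \<open>z \<in> S\<close> by blast
qed

text \<open>The weak maximum principle, without connectedness: if the maximum exceeded \<open>c\<close>, the set where
  it is attained would be nonempty, bounded, open and closed in the plane.\<close>

lemma harmonic_le_boundary:
  assumes "open S" "bounded S" "continuous_on (closure S) h" "holomorphic_gradient S h f"
    and bd: "\<And>z. z \<in> frontier S \<Longrightarrow> h z \<le> c" and "b \<in> S"
  shows "h b \<le> c"
proof (rule ccontr)
  assume neg: "\<not> h b \<le> c"
  have comp: "compact (closure S)"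
    using assms(2) by simp
  obtain m where m: "m \<in> closure S" "\<And>z. z \<in> closure S \<Longrightarrow> h z \<le> h m"
    using continuous_attains_sup[OF comp _ assms(3)] \<open>b \<in> S\<close> closure_subset by blast
  then have "h m \<ge> h b"
    using \<open>b \<in> S\<close> closure_subset[of S] by blast
  then have "h m > c"
    using neg by simp
  let ?K = "{z\<in>closure S. h z = h m}"
  have KS: "?K \<subseteq> S"
    using bd \<open>h m > c\<close> assms(1) by (fastforce simp: frontier_def interior_open)
  have "closed ?K"
    using continuous_closed_preimage_constant[OF assms(3)] by simp
  moreover have "open ?K"
    unfolding open_contains_ball
  proof
    fix b assume b: "b \<in> ?K"
    have "b \<in> S" "\<And>z. z \<in> S \<Longrightarrow> h z \<le> h b"
      using b m KS closure_subset[of S] by auto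
    then obtain r where r: "0 < r" "ball b r \<subseteq> S" "\<And>z. z \<in> ball b r \<Longrightarrow> h z = h b"
      using harmonic_local_maximum[OF assms(1,4), of b] by metis
    have "ball b r \<subseteq> ?K"
    proof
      show "z \<in> ?K" if "z \<in> ball b r" for z
        using r(2) r(3)[OF that] that b closure_subset[of S] by (simp add: subset_iff)
    qed
    then show "\<exists>e>0. ball b e \<subseteq> ?K"
      using r(1) by blast
  qed
  ultimately have "?K = {} \<or> ?K = UNIV"
    by (intro clopen[THEN iffD1] conjI)
  moreover have "m \<in> ?K"
    using m by simp
  moreover have "?K \<noteq> UNIV"
    using bounded_subset[OF assms(2) KS] not_bounded_UNIV by metis
  ultimately show False
    by blast
qed

section \<open>Critical points and crossing curves\<close>

text \<open>Polar coordinates centred at \<open>a\<close>, with radius \<open>t\<close> and angle \<open>\<theta>\<close>.\<close>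

definition polar :: "complex \<Rightarrow> real \<Rightarrow> real \<Rightarrow> complex" where
  "polar a t \<theta> = a + of_real t * cis \<theta>"

lemma dist_polar: "dist a (polar a t \<theta>) = \<bar>t\<bar>"
  by (simp add: polar_def dist_norm norm_mult)

lemma polar_unique:
  assumes "polar a s x = polar a t y" "0 \<le> s" "0 < t" "x < y" "y < x + 2 * pi"
  shows False
proof -
  have "s = t"
    using dist_polar[of a s x] dist_polar[of a t y] assms by simp
  then have "cis x = cis y"
    using assms by (simp add: polar_def)
  then have "cis (y - x) = 1"
    by (simp flip: cis_divide)
  then have "cos (y - x) = 1"
    by (metis cis.sel(1) one_complex.sel(1))
  then obtain n :: int where n: "y - x = real_of_int n * 2 * pi"
    unfolding cos_one_2pi_int by auto
  have "0 < real_of_int n * (2 * pi)" "real_of_int n * (2 * pi) < 1 * (2 * pi)"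
    using n assms(4,5) by linarith+
  then have "0 < real_of_int n" "real_of_int n < 1"
    by (simp_all add: zero_less_mult_iff)
  then show False
    by simp
qed

lemma polar_exists:
  assumes "w \<noteq> a"
  obtains t \<theta> where "0 < t" "\<alpha> \<le> \<theta>" "\<theta> < \<alpha> + 2 * pi" "w = polar a t \<theta>"
proof -
  define z where "z = (w - a) * cis (- \<alpha>)"
  have "z = of_real (cmod z) * cis (Arg2pi z)"
    using Arg2pi_eq[of z] by (simp add: cis_conv_exp)
  then have "z * cis \<alpha> = of_real (cmod z) * cis (\<alpha> + Arg2pi z)"
    by (simp add: cis_mult[symmetric] mult_ac)
  moreover have "z * cis \<alpha> = w - a"
    by (simp add: z_def mult.assoc cis_mult)
  ultimately have "w = polar a (cmod z) (\<alpha> + Arg2pi z)"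
    by (simp add: polar_def algebra_simps)
  moreover have "0 < cmod z"
    using assms by (simp add: z_def)
  ultimately show thesis
    using Arg2pi[of z] by (intro that[of "cmod z" "\<alpha> + Arg2pi z"]) auto
qed

lemma connected_sector: "connected {polar a t \<theta> |t \<theta>. t \<in> T \<and> \<theta> \<in> A}"
  if "convex T" "convex A"
proof -
  have "connected ((\<lambda>(t, \<theta>). polar a t \<theta>) ` (T \<times> A))"
    using that by (intro connected_continuous_image convex_connected convex_Times)
      (auto simp: polar_def case_prod_unfold cis_conv_exp intro!: continuous_intros)
  moreover have "(\<lambda>(t, \<theta>). polar a t \<theta>) ` (T \<times> A) = {polar a t \<theta> |t \<theta>. t \<in> T \<and> \<theta> \<in> A}"
    by auto
  ultimately show ?thesis
    by simp
qed

lemma path_connected_ray: "path_connected ((\<lambda>t. polar a t \<theta>) ` {r..s})"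
  by (intro path_connected_continuous_image convex_imp_path_connected)
    (auto simp: polar_def intro!: continuous_intros)

lemma closed_segment_polar:
  assumes "0 \<le> d"
  shows "closed_segment a (polar a d \<theta>) = (\<lambda>t. polar a t \<theta>) ` {0..d}"
proof (intro equalityI subsetI)
  fix w assume "w \<in> closed_segment a (polar a d \<theta>)"
  then obtain u where "0 \<le> u" "u \<le> 1" "w = (1 - u) *\<^sub>R a + u *\<^sub>R polar a d \<theta>"
    by (auto simp: in_segment)
  then show "w \<in> (\<lambda>t. polar a t \<theta>) ` {0..d}"
    using assms
    by (intro image_eqI[of _ _ "u * d"])
      (auto simp: polar_def scaleR_conv_of_real algebra_simps mult_left_le)
next
  fix w assume "w \<in> (\<lambda>t. polar a t \<theta>) ` {0..d}"
  then obtain t where t: "0 \<le> t" "t \<le> d" "w = polar a t \<theta>"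
    by auto
  show "w \<in> closed_segment a (polar a d \<theta>)"
  proof (cases "d = 0")
    case True
    then show ?thesis
      using t by simp
  next
    case False
    then have "w = (1 - t / d) *\<^sub>R a + (t / d) *\<^sub>R polar a d \<theta>" "0 \<le> t / d" "t / d \<le> 1"
      using t assms by (auto simp: polar_def scaleR_conv_of_real field_simps)
    then show ?thesis
      unfolding in_segment by blast
  qed
qed

text \<open>Two disjoint connected sets \<open>P\<close>, \<open>N\<close> cannot both be entered from \<open>a\<close> along rays that alternate.
  Two rays into \<open>P\<close> are closed up inside \<open>P\<close> to a Jordan curve, which near \<open>a\<close> consists of
  these rays only; so one of the two sectors that they bound is inside and the other outside of the
  curve, and \<open>N\<close> would have to cross it.\<close>

lemma alternating_rays:
  assumes P: "path_connected P" and N: "connected N"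
    and disj: "P \<inter> N = {}" and "a \<notin> P" "a \<notin> N"
    and angles: "\<alpha>0 < \<alpha>1" "\<alpha>1 < \<alpha>2" "\<alpha>2 < \<alpha>3" "\<alpha>3 < \<alpha>0 + 2 * pi"
    and "0 < r"
    and rays: "\<And>t. 0 < t \<Longrightarrow> t \<le> r \<Longrightarrow> polar a t \<alpha>0 \<in> P"
      "\<And>t. 0 < t \<Longrightarrow> t \<le> r \<Longrightarrow> polar a t \<alpha>1 \<in> N"
      "\<And>t. 0 < t \<Longrightarrow> t \<le> r \<Longrightarrow> polar a t \<alpha>2 \<in> P"
      "\<And>t. 0 < t \<Longrightarrow> t \<le> r \<Longrightarrow> polar a t \<alpha>3 \<in> N"
  shows False
proof -
  obtain \<gamma> where \<gamma>: "path \<gamma>" "path_image \<gamma> \<subseteq> P"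
    "pathstart \<gamma> = polar a r \<alpha>0" "pathfinish \<gamma> = polar a r \<alpha>2"
    using P rays(1)[of r] rays(3)[of r] \<open>0 < r\<close> unfolding path_connected_def by blast
  have "a \<in> - path_image \<gamma>"
    using \<gamma> \<open>a \<notin> P\<close> by blast
  then obtain d0 where d0: "0 < d0" "ball a d0 \<subseteq> - path_image \<gamma>"
    using \<gamma>(1) openE[of "- path_image \<gamma>" a] by (auto simp: closed_path_image open_Compl)
  define d where "d = min d0 r / 2"
  have d: "0 < d" "d < r" "d < d0"
    using d0(1) \<open>0 < r\<close> by (auto simp: d_def)
  \<comment> \<open>a set joining the two rays into \<open>P\<close> that meets the disc of radius \<open>d\<close> in two points only; an
    arc in it is closed up by two radii of that disc\<close>
  define X where "X = path_image \<gamma> \<union> (\<lambda>t. polar a t \<alpha>0) ` {d..r} \<union> (\<lambda>t. polar a t \<alpha>2) ` {d..r}"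
  have XP: "X \<subseteq> P"
    using \<gamma>(2) rays(1,3) d by (auto simp: X_def)
  have Xd: "d \<le> dist a w" if "w \<in> X" for w
  proof (cases "w \<in> path_image \<gamma>")
    case True
    then show ?thesis
      using d0 d by (auto simp: subset_iff mem_ball not_less[symmetric])
  next
    case False
    then show ?thesis
      using that d by (auto simp: X_def dist_polar)
  qed
  have Xcball: "w = polar a d \<alpha>0 \<or> w = polar a d \<alpha>2" if w: "w \<in> X" "dist a w \<le> d" for w
  proof -
    have "w \<notin> path_image \<gamma>"
      using d0 d w by (auto simp: subset_iff mem_ball)
    then have "\<exists>t. (w = polar a t \<alpha>0 \<or> w = polar a t \<alpha>2) \<and> d \<le> t \<and> t \<le> r"
      using w(1) unfolding X_def by auto
    then obtain t where t: "w = polar a t \<alpha>0 \<or> w = polar a t \<alpha>2" "d \<le> t" "t \<le> r"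
      by blast
    then have "t = d"
      using w(2) d by (auto simp: dist_polar)
    then show ?thesis
      using t by simp
  qed
  have "path_connected X"
    unfolding X_def
  proof (intro path_connected_Un path_connected_ray path_connected_path_image \<gamma>(1))
    show "path_image \<gamma> \<inter> (\<lambda>t. polar a t \<alpha>0) ` {d..r} \<noteq> {}"
      using \<gamma>(3) pathstart_in_path_image[of \<gamma>] d by auto
    show "(path_image \<gamma> \<union> (\<lambda>t. polar a t \<alpha>0) ` {d..r}) \<inter> (\<lambda>t. polar a t \<alpha>2) ` {d..r} \<noteq> {}"
      using \<gamma>(4) pathfinish_in_path_image[of \<gamma>] d by auto
  qed
  moreover have "polar a d \<alpha>0 \<noteq> polar a d \<alpha>2"
    using polar_unique[of a d \<alpha>0 d \<alpha>2] d angles by auto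
  moreover have "polar a d \<alpha>0 \<in> X" "polar a d \<alpha>2 \<in> X"
    using d by (auto simp: X_def)
  ultimately obtain g where g: "arc g" "path_image g \<subseteq> X"
    "pathstart g = polar a d \<alpha>2" "pathfinish g = polar a d \<alpha>0"
    unfolding path_connected_arcwise by metis
  define l where "l = linepath (polar a d \<alpha>0) a +++ linepath a (polar a d \<alpha>2)"
  define c where "c = l +++ g"
  have ne: "polar a d \<theta> \<noteq> a" for \<theta>
    using dist_polar[of a d \<theta>] d by auto
  have l_image: "path_image l = (\<lambda>t. polar a t \<alpha>0) ` {0..d} \<union> (\<lambda>t. polar a t \<alpha>2) ` {0..d}"
    using d by (simp add: l_def path_image_join closed_segment_polar closed_segment_commute)
  have l_ends: "pathstart l = polar a d \<alpha>0" "pathfinish l = polar a d \<alpha>2"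
    by (simp_all add: l_def)
  have "arc l"
    unfolding l_def
  proof (rule arc_join)
    have "w = a" if w: "w \<in> (\<lambda>t. polar a t \<alpha>0) ` {0..d}" "w \<in> (\<lambda>t. polar a t \<alpha>2) ` {0..d}" for w
    proof -
      have "\<exists>s\<ge>0. w = polar a s \<alpha>0" "\<exists>t\<ge>0. w = polar a t \<alpha>2"
        using w by auto
      then obtain s t where st: "w = polar a s \<alpha>0" "w = polar a t \<alpha>2" "0 \<le> s" "0 \<le> t"
        by blast
      then have "t = 0"
        using polar_unique[of a s \<alpha>0 t \<alpha>2] angles by fastforce
      then show ?thesis
        using st by (simp add: polar_def)
    qed
    then show "path_image (linepath (polar a d \<alpha>0) a) \<inter> path_image (linepath a (polar a d \<alpha>2))
        \<subseteq> {pathstart (linepath a (polar a d \<alpha>2))}"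
      using d by (auto simp: closed_segment_polar closed_segment_commute)
  qed (auto simp: ne ne[symmetric])
  have "simple_path c"
    unfolding c_def
  proof (rule simple_path_join_loop[OF \<open>arc l\<close> g(1)])
    show "path_image l \<inter> path_image g \<subseteq> {pathstart l, pathstart g}"
    proof
      fix w assume "w \<in> path_image l \<inter> path_image g"
      then have "w \<in> X" "dist a w \<le> d"
        using g(2) by (auto simp: l_image dist_polar)
      then show "w \<in> {pathstart l, pathstart g}"
        using Xcball by (auto simp: l_ends g)
    qed
  qed (simp_all add: l_ends g)
  moreover have loop: "pathfinish c = pathstart c"
    by (simp add: c_def l_ends g)
  ultimately have J: "open (inside (path_image c))" "open (outside (path_image c))"
    "inside (path_image c) \<inter> outside (path_image c) = {}"
    "inside (path_image c) \<union> outside (path_image c) = - path_image c"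
    "frontier (inside (path_image c)) = path_image c"
    "frontier (outside (path_image c)) = path_image c"
    using Jordan_inside_outside by blast+
  have c_image: "path_image c = path_image l \<union> path_image g"
    by (simp add: c_def path_image_join l_ends g)
  have "a \<in> path_image c"
    using d by (auto simp: c_image l_image polar_def image_iff intro!: bexI[of _ 0])
  have meets: "ball a d \<inter> inside (path_image c) \<noteq> {}" "ball a d \<inter> outside (path_image c) \<noteq> {}"
    using J(5,6) \<open>a \<in> path_image c\<close> d(1)
    by (metis Int_commute disjoint_iff_not_equal frontier_straddle mem_ball)+
  define S1 where "S1 = {polar a t \<theta> |t \<theta>. t \<in> {0<..<d} \<and> \<theta> \<in> {\<alpha>0<..<\<alpha>2}}"
  define S2 where "S2 = {polar a t \<theta> |t \<theta>. t \<in> {0<..<d} \<and> \<theta> \<in> {\<alpha>2<..<\<alpha>0 + 2 * pi}}"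
  have off: "polar a t \<theta> \<notin> path_image c"
    if "0 < t" "t < d" "\<alpha>0 < \<theta>" "\<theta> < \<alpha>0 + 2 * pi" "\<theta> \<noteq> \<alpha>2" for t \<theta>
  proof
    assume "polar a t \<theta> \<in> path_image c"
    moreover have "polar a t \<theta> \<notin> path_image g"
      using g(2) Xd that by (fastforce simp: dist_polar)
    ultimately consider s where "polar a s \<alpha>0 = polar a t \<theta>" "0 \<le> s"
      | s where "polar a s \<alpha>2 = polar a t \<theta>" "0 \<le> s"
      by (auto simp: c_image l_image)
    then show False
    proof cases
      case 1
      then show False
        using polar_unique[of a s \<alpha>0 t \<theta>] that by simp
    next
      case 2
      then have "s = t"
        using dist_polar[of a s \<alpha>2] dist_polar[of a t \<theta>] that by simp
      then show False
        using polar_unique[of a s \<alpha>2 t \<theta>] polar_unique[of a t \<theta> s \<alpha>2] 2 that angles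
        by (cases "\<theta> < \<alpha>2") auto
    qed
  qed
  have sectors: "ball a d - path_image c \<subseteq> S1 \<union> S2"
  proof
    fix w assume w: "w \<in> ball a d - path_image c"
    then have "w \<noteq> a"
      using \<open>a \<in> path_image c\<close> by blast
    then obtain t \<theta> where t: "0 < t" "\<alpha>0 \<le> \<theta>" "\<theta> < \<alpha>0 + 2 * pi" "w = polar a t \<theta>"
      by (rule polar_exists[where \<alpha> = \<alpha>0])
    have "t < d"
      using w t by (simp add: dist_polar)
    then have "w \<in> path_image c" if "\<theta> = \<alpha>0 \<or> \<theta> = \<alpha>2"
      using that t by (auto simp: c_image l_image)
    then have "\<theta> \<noteq> \<alpha>0" "\<theta> \<noteq> \<alpha>2"
      using w by auto
    then have "t \<in> {0<..<d}" "\<theta> \<in> {\<alpha>0<..<\<alpha>2} \<or> \<theta> \<in> {\<alpha>2<..<\<alpha>0 + 2 * pi}"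
      using t \<open>t < d\<close> by auto
    then show "w \<in> S1 \<union> S2"
      using t(4) unfolding S1_def S2_def by blast
  qed
  have "polar a (d / 2) \<alpha>1 \<in> N \<inter> S1" "polar a (d / 2) \<alpha>3 \<in> N \<inter> S2"
    using rays(2,4)[of "d / 2"] d angles unfolding S1_def S2_def by fastforce+
  moreover have "connected S1" "connected S2"
    unfolding S1_def S2_def by (intro connected_sector; simp)+
  ultimately have conn: "connected (S1 \<union> N \<union> S2)"
    by (intro connected_Un N) auto
  have "(S1 \<union> N \<union> S2) \<inter> path_image c = {}"
  proof -
    have "S1 \<inter> path_image c = {}" "S2 \<inter> path_image c = {}"
      using off angles unfolding S1_def S2_def by fastforce+
    moreover have "path_image c \<subseteq> insert a P"
    proof
      fix w assume "w \<in> path_image c"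
      then consider "w \<in> X" | t where "0 \<le> t" "t \<le> d" "w = polar a t \<alpha>0 \<or> w = polar a t \<alpha>2"
        using g(2) by (auto simp: c_image l_image)
      then show "w \<in> insert a P"
      proof cases
        case 1
        then show ?thesis
          using XP by blast
      next
        case 2
        then show ?thesis
          using rays(1,3)[of t] d by (cases "t = 0") (auto simp: polar_def)
      qed
    qed
    ultimately show ?thesis
      using disj \<open>a \<notin> N\<close> by blast
  qed
  then have "S1 \<union> N \<union> S2 \<subseteq> inside (path_image c) \<union> outside (path_image c)"
    using J(4) by blast
  moreover have "inside (path_image c) \<inter> outside (path_image c) \<inter> (S1 \<union> N \<union> S2) = {}"
    using J(3) by blast
  ultimately have "inside (path_image c) \<inter> (S1 \<union> N \<union> S2) = {} \<or> outside (path_image c) \<inter> (S1 \<union> N \<union> S2) = {}"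
    using connectedD[OF conn J(1,2)] by blast
  moreover have "ball a d \<inter> inside (path_image c) \<subseteq> S1 \<union> S2" "ball a d \<inter> outside (path_image c) \<subseteq> S1 \<union> S2"
    using sectors J(4) by blast+
  ultimately show False
    using meets by blast
qed

text \<open>If \<open>g\<close> vanishes at \<open>a\<close> to order \<open>n \<ge> 2\<close>, then \<open>Re g\<close> has alternating signs on \<open>2 n \<ge> 4\<close>
  equally spaced rays.\<close>

lemma critical_point_rays:
  assumes der: "\<And>z. z \<in> ball a R \<Longrightarrow> (g has_field_derivative f z) (at z)"
    and "0 < R" "g a = 0" "f a = 0" "\<not> g constant_on ball a R"
  obtains \<alpha> n r where "(2::nat) \<le> n" "0 < r" "r < R"
    "\<And>j t. 0 < t \<Longrightarrow> t \<le> r \<Longrightarrow> (-1) ^ j * Re (g (polar a t (\<alpha> + real j * pi / real n))) > 0"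
proof -
  have "g holomorphic_on ball a R"
    unfolding holomorphic_on_open[OF open_ball] using der by blast
  then obtain q r n where n: "0 < n" and r: "0 < r" "ball a r \<subseteq> ball a R"
    and q: "q holomorphic_on ball a r" and g: "\<And>w. w \<in> ball a r \<Longrightarrow> g w = (w - a) ^ n * q w"
    and q0: "\<And>w. w \<in> ball a r \<Longrightarrow> q w \<noteq> 0"
    using holomorphic_factor_zero_nonconstant[OF _ open_ball connected_ball _ assms(3,5)] \<open>0 < R\<close>
    by (metis centre_in_ball)
  \<comment> \<open>the order of the zero is at least two, since the derivative vanishes too\<close>
  have "n \<noteq> 1"
  proof
    assume "n = 1"
    have "(q has_field_derivative deriv q a) (at a)"
      using q r(1) by (intro holomorphic_derivI[OF q open_ball]) simp
    then have "((\<lambda>w. (w - a) * q w) has_field_derivative q a) (at a)"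
      by (auto intro!: derivative_eq_intros)
    then have "(g has_field_derivative q a) (at a)"
      using r(1) g \<open>n = 1\<close> by (elim DERIV_cong_ev[THEN iffD1, rotated -1])
        (auto intro!: eventually_nhds_in_open[THEN eventually_mono, of "ball a r"])
    then have "q a = 0"
      using der[of a] \<open>0 < R\<close> \<open>f a = 0\<close> DERIV_unique by fastforce
    then show False
      using q0[of a] r(1) by simp
  qed
  then have "2 \<le> n"
    using n by simp
  define c where "c = q a"
  have "cmod c > 0"
    using q0[of a] r(1) by (simp add: c_def)
  have "isCont q a"
    using holomorphic_on_imp_continuous_on[OF q] r(1)
    by (simp add: continuous_on_eq_continuous_at)
  then obtain e where e: "0 < e" "\<And>w. dist w a < e \<Longrightarrow> dist (q w) c < cmod c"
    using \<open>cmod c > 0\<close> unfolding continuous_at_eps_delta c_def by blast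
  define s where "s = min e r / 2"
  have s: "0 < s" "s < e" "s < r"
    using e(1) r(1) by (auto simp: s_def)
  have "r \<le> R"
    using r by (simp add: ball_subset_ball_iff)
  have main: "(-1) ^ j * Re (g (polar a t (- Arg c / n + real j * pi / n))) > 0"
    if t: "0 < t" "t \<le> s" for j t
  proof -
    define \<theta> where "\<theta> = - Arg c / n + real j * pi / n"
    define w where "w = polar a t \<theta>"
    have "w \<in> ball a r"
      using t s by (simp add: w_def dist_polar)
    have wa: "dist w a < e"
      using t s by (simp add: w_def dist_polar dist_commute)
    have "real n * \<theta> = real j * pi - Arg c"
      using n by (simp add: \<theta>_def field_simps)
    then have "(w - a) ^ n = of_real (t ^ n) * cis (real j * pi - Arg c)"
      by (simp add: w_def polar_def power_mult_distrib Complex.DeMoivre)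
    also have "cis (real j * pi - Arg c) = cis (real j * pi) * cis (- Arg c)"
      by (simp add: cis_mult)
    also have "cis (real j * pi) = (-1) ^ j"
      by (simp flip: Complex.DeMoivre)
    finally have "g w = of_real (t ^ n) * ((-1) ^ j * (cis (- Arg c) * q w))"
      using g[OF \<open>w \<in> ball a r\<close>] by simp
    then have "g w = of_real (t ^ n * (-1) ^ j) * (cis (- Arg c) * q w)"
      by simp
    then have "Re (g w) = t ^ n * (-1) ^ j * Re (cis (- Arg c) * q w)"
      by (simp only: times_complex.sel Re_complex_of_real Im_complex_of_real mult_zero_left diff_zero)
    then have "(-1) ^ j * Re (g w) = t ^ n * ((-1) ^ j * (-1) ^ j) * Re (cis (- Arg c) * q w)"
      by (simp add: mult_ac)
    then have 1: "(-1) ^ j * Re (g w) = t ^ n * Re (cis (- Arg c) * q w)"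
      by (simp flip: power_mult_distrib)
    have "cis (- Arg c) * c = of_real (cmod c)"
      using rcis_cmod_Arg[of c] unfolding rcis_def
      by (metis add.right_inverse cis_mult cis_zero mult.commute mult.left_commute mult.right_neutral)
    then have "cis (- Arg c) * q w = of_real (cmod c) + cis (- Arg c) * (q w - c)"
      by (simp add: algebra_simps)
    moreover have "\<bar>Re (cis (- Arg c) * (q w - c))\<bar> < cmod c"
    proof -
      have "\<bar>Re (cis (- Arg c) * (q w - c))\<bar> \<le> cmod (cis (- Arg c) * (q w - c))"
        by (rule abs_Re_le_cmod)
      also have "\<dots> = dist (q w) c"
        by (simp add: norm_mult dist_norm)
      finally show ?thesis
        using e(2)[OF wa] by simp
    qed
    ultimately have "Re (cis (- Arg c) * q w) > 0"
      by simp
    then show ?thesis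
      using 1 t by (simp add: w_def \<theta>_def)
  qed
  show thesis
    by (rule that[of n s "- Arg c / n"]) (use main \<open>2 \<le> n\<close> s \<open>r \<le> R\<close> in auto)
qed

section \<open>Level sets of harmonic functions\<close>

lemma holomorphic_gradient_uminus:
  assumes "holomorphic_gradient S h f"
  shows "holomorphic_gradient S (\<lambda>z. - h z) (\<lambda>z. - f z)"
  unfolding holomorphic_gradient_def
proof (intro conjI ballI)
  show "(\<lambda>z. - f z) holomorphic_on S"
    using assms by (auto simp: holomorphic_gradient_def intro: holomorphic_intros)
  fix z assume "z \<in> S"
  then have "((\<lambda>z. - h z) has_derivative (\<lambda>v. - Re (f z * v))) (at z)"
    using assms by (intro has_derivative_minus) (simp add: holomorphic_gradient_def)
  then show "((\<lambda>z. - h z) has_derivative (\<lambda>v. Re (- f z * v))) (at z)"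
    by simp
qed

text \<open>By the maximum principle every component of \<open>{h > 0}\<close> reaches the boundary.\<close>

lemma connected_superlevel:
  assumes "compact V" and cont: "continuous_on V h" and grad: "holomorphic_gradient (interior V) h f"
    and bd: "connected {z \<in> frontier V. h z > 0}"
  shows "connected {z \<in> V. h z > 0}"
proof (rule ccontr)
  let ?P = "{z \<in> V. h z > 0}" and ?Q = "{z \<in> frontier V. h z > 0}"
  have frV: "frontier V \<subseteq> V" "V - interior V = frontier V" "closed V"
    using assms(1) by (auto simp: frontier_subset_compact frontier_def compact_imp_closed)
  assume "\<not> connected ?P"
  then obtain U1 U2 where U: "open U1" "open U2" "?P \<subseteq> U1 \<union> U2" "U1 \<inter> U2 \<inter> ?P = {}"
    "U1 \<inter> ?P \<noteq> {}" "U2 \<inter> ?P \<noteq> {}"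
    unfolding connected_def by blast
  \<comment> \<open>a piece of a separation cannot avoid the boundary: \<open>h\<close> would be nonpositive on its
    frontier, although it is positive in the piece\<close>
  have off_boundary: False
    if U: "open U" "open U'" "?P \<subseteq> U \<union> U'" "U \<inter> U' \<inter> ?P = {}" "U \<inter> ?P \<noteq> {}" "U \<inter> ?Q = {}" for U U'
  proof -
    define E where "E = U \<inter> ?P"
    have E_eq: "E = U \<inter> (interior V \<inter> h -` {0<..})"
      using U(6) frV interior_subset[of V] by (auto simp: E_def)
    have "continuous_on (interior V) h"
      using cont interior_subset continuous_on_subset by blast
    then have "open (interior V \<inter> h -` {0<..})"
      by (intro continuous_open_preimage) auto
    then have "open E"
      unfolding E_eq using U(1) by (rule open_Int[rotated])
    have "E \<subseteq> V"
      by (auto simp: E_def)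
    then have clV: "closure E \<subseteq> V"
      using frV(3) by (rule closure_minimal)
    have "h z \<le> 0" if z: "z \<in> frontier E" for z
    proof (rule ccontr)
      assume "\<not> h z \<le> 0"
      moreover have "z \<in> closure E" "z \<notin> E"
        using z \<open>open E\<close> by (auto simp: frontier_def interior_open)
      ultimately have "z \<in> U'"
        using clV U(3) by (auto simp: E_def)
      then have "U' \<inter> E \<noteq> {}"
        using \<open>z \<in> closure E\<close> open_Int_closure_eq_empty[OF U(2), of E] by blast
      then show False
        using U(4) by (auto simp: E_def)
    qed
    moreover have "bounded E"
      using \<open>E \<subseteq> V\<close> assms(1) bounded_subset compact_imp_bounded by blast
    moreover have "holomorphic_gradient E h f"
      using grad by (rule holomorphic_gradient_subset) (auto simp: E_eq)
    moreover have "continuous_on (closure E) h"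
      using cont clV by (rule continuous_on_subset)
    ultimately have "h b \<le> 0" if "b \<in> E" for b
      using harmonic_le_boundary[OF \<open>open E\<close>] that by blast
    then show False
      using U(5) by (force simp: E_def)
  qed
  have QP: "?Q \<subseteq> ?P"
    using frV(1) by auto
  have "U1 \<inter> ?Q = {} \<or> U2 \<inter> ?Q = {}"
    by (rule connectedD[OF bd U(1,2)]) (use QP U in blast)+
  then show False
  proof
    assume "U1 \<inter> ?Q = {}"
    with off_boundary[OF U(1,2,3,4,5)] show False .
  next
    assume "U2 \<inter> ?Q = {}"
    moreover have "?P \<subseteq> U2 \<union> U1" "U2 \<inter> U1 \<inter> ?P = {}"
      using U by blast+
    ultimately show False
      using off_boundary[OF U(2,1)] U(6) by blast
  qed
qed

text \<open>A harmonic function, not identically zero, whose positive and negative boundary sets are both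
  connected has no
  critical point on its zero set: from such a point, four regions of alternating sign would emanate.
  The set \<open>{h > 0}\<close> is enlarged to an open connected, hence path-connected, set by a continuous extension
  of \<open>h\<close> to the plane; no local connectedness of \<open>V\<close> at its boundary is needed.\<close>

lemma no_critical_zero:
  assumes "compact V" "connected (interior V)" and cont: "continuous_on V h"
    and grad: "holomorphic_gradient (interior V) h f"
    and pos: "connected {z \<in> frontier V. h z > 0}" and neg: "connected {z \<in> frontier V. h z < 0}"
    and a: "a \<in> interior V" "h a = 0" and b: "b \<in> interior V" "h b \<noteq> 0"
  shows "f a \<noteq> 0"
proof
  assume "f a = 0"
  obtain R where R: "0 < R" "ball a R \<subseteq> interior V"
    using a(1) open_interior openE by blast
  obtain g where g: "\<And>z. z \<in> ball a R \<Longrightarrow> (g has_field_derivative f z) (at z)"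
    "\<And>z. z \<in> ball a R \<Longrightarrow> Re (g z) = h z - h a" "g a = 0"
    using holomorphic_gradient_primitive[OF holomorphic_gradient_subset[OF grad R(2)] R(1)] by blast
  have hol: "f holomorphic_on interior V"
    and der: "\<And>z. z \<in> interior V \<Longrightarrow> (h has_derivative (\<lambda>v. Re (f z * v))) (at z)"
    using grad by (auto simp: holomorphic_gradient_def)
  have "\<not> g constant_on ball a R"
  proof
    assume "g constant_on ball a R"
    then obtain k where k: "\<And>z. z \<in> ball a R \<Longrightarrow> g z = k"
      by (auto simp: constant_on_def)
    have f0: "f z = 0" if "z \<in> ball a R" for z
    proof -
      have "(g has_field_derivative 0) (at z)"
        using k that
        by (intro has_field_derivative_transform_within_open[of "\<lambda>z. k" 0 z "ball a R" g]) auto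
      then show ?thesis
        using g(1)[OF that] DERIV_unique by blast
    qed
    have "f z = 0" if "z \<in> interior V" for z
      by (rule analytic_continuation[OF hol open_interior assms(2) R(2) a(1) _ _ that])
        (use f0 R(1) in \<open>auto simp: islimpt_ball\<close>)
    then have "(h has_derivative (\<lambda>v. 0)) (at z)" if "z \<in> interior V" for z
      using der[OF that] that by auto
    then have "h b = h a"
      using has_derivative_zero_unique_connected[OF open_interior assms(2) _ b(1) a(1)] by blast
    then show False
      using a b by simp
  qed
  then obtain \<alpha> n r where n: "(2::nat) \<le> n" and r: "0 < r" "r < R" and
    rays: "\<And>j t. 0 < t \<Longrightarrow> t \<le> r \<Longrightarrow> (-1) ^ j * Re (g (polar a t (\<alpha> + real j * pi / real n))) > 0"
    using critical_point_rays[OF g(1) R(1) g(3) \<open>f a = 0\<close>] by metis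
  let ?V1 = "{z \<in> V. h z > 0}" and ?N = "{z \<in> V. h z < 0}"
  have near: "polar a t \<theta> \<in> V" "Re (g (polar a t \<theta>)) = h (polar a t \<theta>)" if "0 < t" "t \<le> r" for t \<theta>
  proof -
    have "polar a t \<theta> \<in> ball a R"
      using that r by (simp add: dist_polar)
    then show "polar a t \<theta> \<in> V" "Re (g (polar a t \<theta>)) = h (polar a t \<theta>)"
      using R(2) interior_subset[of V] g(2) a(2) by auto
  qed
  have ray: "(-1) ^ j * h (polar a t (\<alpha> + real j * pi / real n)) > 0" if "0 < t" "t \<le> r" for j t
    using rays[OF that, of j] near(2)[OF that] by simp
  have conV1: "connected ?V1"
    using connected_superlevel[OF assms(1) cont grad pos] .
  have conN: "connected ?N"
    using connected_superlevel[OF assms(1) continuous_on_minus[OF cont] holomorphic_gradient_uminus[OF grad]]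
      neg by simp
  obtain H where H: "continuous_on UNIV H" "\<And>x. x \<in> V \<Longrightarrow> H x = h x"
    using Tietze_unbounded[of V h UNIV] cont assms(1) by (auto simp: compact_imp_closed)
  define P where "P = connected_component_set {z. H z > 0} (polar a r \<alpha>)"
  have "open {z. H z > 0}"
    using H(1) by (intro open_Collect_less) auto
  then have "path_connected P"
    unfolding P_def by (intro connected_open_path_connected open_connected_component) auto
  have V1P: "?V1 \<subseteq> P"
    unfolding P_def
  proof (rule connected_component_maximal[OF _ conV1])
    show "polar a r \<alpha> \<in> ?V1"
      using near[of r \<alpha>] ray[of r 0] r by simp
  qed (use H(2) in auto)
  have P_pos: "H z > 0" if "z \<in> P" for z
    using that connected_component_subset[of "{z. H z > 0}"] by (auto simp: P_def)
  have P0: "polar a t (\<alpha> + real j * pi / real n) \<in> P" if "0 < t" "t \<le> r" "even j" for j t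
    using V1P near[of t] ray[of t j] that by auto
  have N0: "polar a t (\<alpha> + real j * pi / real n) \<in> ?N" if "0 < t" "t \<le> r" "odd j" for j t
    using near[of t] ray[of t j] that by auto
  have pin: "0 < pi / real n" "3 * (pi / real n) < 2 * pi"
    using n pi_gt_zero by (auto simp: field_simps)
  show False
  proof (rule alternating_rays[OF \<open>path_connected P\<close> conN, where a = a and r = r
        and ?\<alpha>0.0 = \<alpha> and ?\<alpha>1.0 = "\<alpha> + pi / real n"
        and ?\<alpha>2.0 = "\<alpha> + 2 * (pi / real n)" and ?\<alpha>3.0 = "\<alpha> + 3 * (pi / real n)"])
    show "P \<inter> ?N = {}"
      using P_pos H(2) by fastforce
    show "a \<notin> P"
      using P_pos[of a] H(2)[of a] a interior_subset[of V] by auto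
    show "a \<notin> ?N"
      using a by simp
    show "polar a t \<alpha> \<in> P" "polar a t (\<alpha> + 2 * (pi / real n)) \<in> P"
      "polar a t (\<alpha> + pi / real n) \<in> ?N" "polar a t (\<alpha> + 3 * (pi / real n)) \<in> ?N"
      if "0 < t" "t \<le> r" for t
      using P0[OF that, of 0] P0[OF that, of 2] N0[OF that, of 1] N0[OF that, of 3] by simp_all
  qed (use r pin in simp_all)
qed

section \<open>Boundaries of convex sets\<close>

lemma frontier_ray_unique:
  fixes W :: "complex set"
  assumes "convex W" "p \<in> interior W" "q \<in> frontier W" "q' \<in> frontier W"
    and sgn: "sgn (q - p) = sgn (q' - p)" and le: "norm (q - p) \<le> norm (q' - p)"
  shows "q = q'"
proof (rule ccontr)
  assume "q \<noteq> q'"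
  have "q' \<noteq> p" "q \<noteq> p"
    using assms(2-4) by (auto simp: frontier_def)
  define s where "s = norm (q - p) / norm (q' - p)"
  have eq: "q - p = s *\<^sub>R (q' - p)"
  proof -
    have "q - p = norm (q - p) *\<^sub>R sgn (q - p)" "q' - p = norm (q' - p) *\<^sub>R sgn (q' - p)"
      using \<open>q' \<noteq> p\<close> \<open>q \<noteq> p\<close> by (simp_all add: sgn_div_norm)
    then show ?thesis
      unfolding s_def sgn by (metis \<open>q' \<noteq> p\<close> eq_iff_diff_eq_0 nonzero_divide_eq_eq norm_eq_zero scaleR_scaleR)
  qed
  have "s \<noteq> 1"
    using eq \<open>q \<noteq> q'\<close> by auto
  then have "0 < s" "s < 1"
    using le \<open>q' \<noteq> p\<close> \<open>q \<noteq> p\<close> by (auto simp: s_def less_le)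
  then have "q' - (1 - s) *\<^sub>R (q' - p) \<in> interior W"
    using assms by (intro mem_interior_closure_convex_shrink) (auto simp: frontier_def)
  moreover have "q' - (1 - s) *\<^sub>R (q' - p) = q"
    using eq by (simp add: algebra_simps)
  ultimately show False
    using assms(3) by (auto simp: frontier_def)
qed

text \<open>Seen from an interior point, the boundary of a bounded convex set is a circle, on which every
  line through the point cuts off two open half circles.\<close>

lemma connected_boundary_halfplane:
  fixes W :: "complex set" and F :: "complex \<Rightarrow> complex"
  assumes "convex W" "bounded W" "p \<in> interior W"
    and "compact T" "continuous_on T F" "inj_on F T" "F ` T = frontier W"
  shows "connected {z \<in> T. n \<bullet> (F z - p) > 0}"
proof -
  define \<sigma> where "\<sigma> = (\<lambda>z. sgn (F z - p))"
  have ne: "F z \<noteq> p" if "z \<in> T" for z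
    using assms(3,7) that by (force simp: frontier_def)
  have "continuous_on T \<sigma>"
    unfolding \<sigma>_def using ne by (intro continuous_on_sgn continuous_intros assms) auto
  moreover have "inj_on \<sigma> T"
  proof (rule inj_onI)
    fix x y assume xy: "x \<in> T" "y \<in> T" "\<sigma> x = \<sigma> y"
    then have "F x \<in> frontier W" "F y \<in> frontier W"
      using assms(7) by auto
    then have "F x = F y"
      using frontier_ray_unique[OF assms(1,3), of "F x" "F y"]
        frontier_ray_unique[OF assms(1,3), of "F y" "F x"] xy(3)
      by (cases "norm (F x - p) \<le> norm (F y - p)") (auto simp: \<sigma>_def)
    then show "x = y"
      using assms(6) xy by (simp add: inj_on_def)
  qed
  moreover have "\<sigma> ` T = sphere 0 1"
  proof (intro equalityI subsetI)
    fix u assume "u \<in> \<sigma> ` T"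
    then show "u \<in> sphere 0 1"
      using ne by (auto simp: \<sigma>_def norm_sgn)
  next
    fix u :: complex assume u: "u \<in> sphere 0 1"
    then have "u \<noteq> 0"
      by auto
    then obtain d where d: "0 < d" "p + d *\<^sub>R u \<in> frontier W"
      using ray_to_frontier[OF assms(2,3)] by metis
    then obtain z where z: "z \<in> T" "F z = p + d *\<^sub>R u"
      using assms(7) by (metis imageE)
    then have "\<sigma> z = u"
      using d u by (simp add: \<sigma>_def sgn_scaleR) (simp add: sgn_div_norm)
    then show "u \<in> \<sigma> ` T"
      using z by blast
  qed
  ultimately obtain \<tau> where \<tau>: "homeomorphism T (sphere 0 1) \<sigma> \<tau>"
    using homeomorphism_compact[OF assms(4)] by metis
  have half: "connected {u \<in> sphere 0 1. n \<bullet> u > 0}"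
  proof -
    have "connected (sgn ` {u. n \<bullet> u > 0})"
      by (intro connected_continuous_image continuous_on_sgn continuous_intros
          convex_connected convex_halfspace_gt) auto
    moreover have "sgn ` {u. n \<bullet> u > 0} = {u \<in> sphere 0 1. n \<bullet> u > 0}"
    proof (intro equalityI subsetI)
      fix u assume "u \<in> sgn ` {u. n \<bullet> u > 0}"
      then obtain v where v: "u = sgn v" "n \<bullet> v > 0"
        by auto
      then have "v \<noteq> 0"
        by auto
      then show "u \<in> {u \<in> sphere 0 1. n \<bullet> u > 0}"
        using v by (simp add: norm_sgn) (simp add: sgn_div_norm)
    next
      fix u assume "u \<in> {u \<in> sphere 0 1. n \<bullet> u > 0}"
      then show "u \<in> sgn ` {u. n \<bullet> u > 0}"
        by (intro image_eqI[of _ _ u]) (auto simp: sgn_div_norm)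
    qed
    ultimately show ?thesis
      by simp
  qed
  have "connected (\<tau> ` {u \<in> sphere 0 1. n \<bullet> u > 0})"
    using homeomorphism_cont2[OF \<tau>] by (intro connected_continuous_image half) (auto intro: continuous_on_subset)
  moreover have "\<tau> ` {u \<in> sphere 0 1. n \<bullet> u > 0} = {z \<in> T. n \<bullet> (F z - p) > 0}"
  proof -
    have sign: "n \<bullet> \<sigma> z > 0 \<longleftrightarrow> n \<bullet> (F z - p) > 0" if "z \<in> T" for z
      using ne[OF that] by (simp add: \<sigma>_def sgn_div_norm zero_less_mult_iff)
    show ?thesis
    proof (intro equalityI subsetI)
      fix z assume "z \<in> \<tau> ` {u \<in> sphere 0 1. n \<bullet> u > 0}"
      then obtain u where u: "u \<in> sphere 0 1" "n \<bullet> u > 0" "z = \<tau> u"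
        by blast
      then have "z \<in> T" "\<sigma> z = u"
        using homeomorphism_image2[OF \<tau>] homeomorphism_apply2[OF \<tau>] by auto
      then show "z \<in> {z \<in> T. n \<bullet> (F z - p) > 0}"
        using sign[OF \<open>z \<in> T\<close>] u(2) by simp
    next
      fix z assume z: "z \<in> {z \<in> T. n \<bullet> (F z - p) > 0}"
      then have "\<sigma> z \<in> sphere 0 1" "\<tau> (\<sigma> z) = z" "n \<bullet> \<sigma> z > 0"
        using homeomorphism_image1[OF \<tau>] homeomorphism_apply1[OF \<tau>] sign by auto
      then show "z \<in> \<tau> ` {u \<in> sphere 0 1. n \<bullet> u > 0}"
        by (intro image_eqI[of _ _ "\<sigma> z"]) auto
    qed
  qed
  ultimately show ?thesis
    by simp
qed

section \<open>Polygonal curves\<close>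

lemma polyline_image:
  assumes "length xs = length ys" "2 \<le> length xs" "0 \<le> t" "t \<le> 1"
    and "\<And>i t. \<lbrakk>Suc i < length xs; 0 \<le> t; t \<le> 1\<rbrakk> \<Longrightarrow>
      F (linepath (xs ! i) (xs ! Suc i) t) = linepath (ys ! i) (ys ! Suc i) t"
  shows "F (polyline xs t) = polyline ys t"
  using assms
proof (induction xs arbitrary: ys t rule: polyline.induct)
  case (3 a b)
  have "length ys = Suc (Suc 0)"
    using "3.prems"(1) by simp
  then obtain a' b' where "ys = [a', b']"
    by (auto simp: length_Suc_conv)
  then show ?case
    using "3.prems"(5)[of 0 t] "3.prems"(3,4) by simp
next
  case (4 a b c xs)
  obtain a' b' c' zs where ys: "ys = a' # b' # c' # zs"
    using "4.prems"(1) by (metis length_Suc_conv)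
  have first: "F (linepath a b t) = linepath a' b' t" if "0 \<le> t" "t \<le> 1" for t
    using "4.prems"(5)[of 0 t] that by (simp add: ys)
  have rest: "F (polyline (b # c # xs) t) = polyline (b' # c' # zs) t" if "0 \<le> t" "t \<le> 1" for t
  proof (rule "4.IH"[OF _ _ that])
    show "length (b # c # xs) = length (b' # c' # zs)" "2 \<le> length (b # c # xs)"
      using "4.prems"(1) by (simp_all add: ys)
    show "F (linepath ((b # c # xs) ! i) ((b # c # xs) ! Suc i) t)
        = linepath ((b' # c' # zs) ! i) ((b' # c' # zs) ! Suc i) t"
      if "Suc i < length (b # c # xs)" "0 \<le> t" "t \<le> 1" for i t
      using "4.prems"(5)[of "Suc i" t] that by (simp add: ys)
  qed
  show ?case
    using first[of "2 * t"] rest[of "2 * t - 1"] "4.prems"(3,4) by (simp add: ys joinpaths_def)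
qed auto

lemma polyline_ends:
  assumes "xs \<noteq> []"
  shows "pathstart (polyline xs) = hd xs" "pathfinish (polyline xs) = last xs"
proof -
  show "pathstart (polyline xs) = hd xs"
    using assms by (induction xs rule: polyline.induct) auto
  show "pathfinish (polyline xs) = last xs"
    using assms by (induction xs rule: polyline.induct) auto
qed

lemma polyline_vertices: "set xs \<subseteq> path_image (polyline xs)"
proof (induction xs rule: polyline.induct)
  case (4 a b c xs)
  then show ?case
    by (auto simp: path_image_join polyline_ends)
qed auto

lemma closed_polyline_loop:
  "vs \<noteq> [] \<Longrightarrow> pathfinish (closed_polyline vs) = pathstart (closed_polyline vs)"
  by (simp add: closed_polyline_def polyline_ends)

text \<open>The region is compact with the Jordan curve as frontier, so its interior is a union of
  components of the complement of the curve, and not the unbounded one.\<close>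

lemma polygon_interior:
  assumes "polygon V vs"
  shows "interior V = inside (path_image (closed_polyline vs))"
proof -
  let ?C = "path_image (closed_polyline vs)"
  have V: "compact V" "interior V \<noteq> {}" "frontier V = ?C" "simple_path (closed_polyline vs)" "vs \<noteq> []"
    using assms by (auto simp: polygon_def)
  have J: "connected (inside ?C)" "connected (outside ?C)" "\<not> bounded (outside ?C)"
    "inside ?C \<inter> outside ?C = {}" "inside ?C \<union> outside ?C = - ?C"
    using Jordan_inside_outside[OF V(4) closed_polyline_loop[OF V(5)]] by blast+
  have "closed V"
    using V(1) by (rule compact_imp_closed)
  then have split: "- ?C = interior V \<union> - V" "open (- V)"
    using V(3) interior_subset[of V] by (auto simp: frontier_def)
  have out: "interior V \<inter> outside ?C = {}"
  proof -
    have "interior V \<inter> outside ?C = {} \<or> - V \<inter> outside ?C = {}"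
      by (rule connectedD[OF J(2) open_interior split(2)])
        (use split J(5) interior_subset[of V] in blast)+
    moreover have "\<not> outside ?C \<subseteq> V"
      using J(3) V(1) bounded_subset compact_imp_bounded by blast
    ultimately show ?thesis
      by blast
  qed
  then have "interior V \<subseteq> inside ?C"
    using split(1) J(5) by blast
  moreover have "interior V \<inter> inside ?C = {} \<or> - V \<inter> inside ?C = {}"
    by (rule connectedD[OF J(1) open_interior split(2)])
      (use split J(5) interior_subset[of V] in blast)+
  ultimately show ?thesis
    using V(2) split(1) J(5) by blast
qed

lemma polygon_interior_connected:
  assumes "polygon V vs"
  shows "connected (interior V)" "frontier (interior V) = frontier V"
proof -
  have "simple_path (closed_polyline vs)" "vs \<noteq> []"
    using assms by (auto simp: polygon_def)
  from Jordan_inside_outside[OF this(1) closed_polyline_loop[OF this(2)]]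
  show "connected (interior V)" "frontier (interior V) = frontier V"
    using polygon_interior[OF assms] assms by (auto simp: polygon_def)
qed

section \<open>Proper local homeomorphisms onto convex sets\<close>

lemma locally_injective_open_map:
  fixes F :: "'a::euclidean_space \<Rightarrow> 'a"
  assumes "continuous_on S F" "T \<subseteq> S" "open T"
    and inj: "\<And>x. x \<in> S \<Longrightarrow> \<exists>U. open U \<and> x \<in> U \<and> U \<subseteq> S \<and> inj_on F U"
  shows "open (F ` T)"
proof -
  have "\<exists>B. open B \<and> F x \<in> B \<and> B \<subseteq> F ` T" if x: "x \<in> T" for x
  proof -
    obtain U where U: "open U" "x \<in> U" "U \<subseteq> S" "inj_on F U"
      using inj x assms(2) by blast
    have "open (F ` (T \<inter> U))"
      using assms(1) U assms(2,3)
      by (intro invariance_of_domain) (auto intro: continuous_on_subset inj_on_subset)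
    then show ?thesis
      using x U(2) by blast
  qed
  then show ?thesis
    by (subst open_subopen) auto
qed

lemma proper_local_homeomorphism_covering:
  fixes F :: "'a::euclidean_space \<Rightarrow> 'a"
  assumes "open S" "open D" and cont: "continuous_on S F" and surj: "F ` S = D"
    and inj: "\<And>x. x \<in> S \<Longrightarrow> \<exists>U. open U \<and> x \<in> U \<and> U \<subseteq> S \<and> inj_on F U"
    and proper: "\<And>K. compact K \<Longrightarrow> K \<subseteq> D \<Longrightarrow> compact (S \<inter> F -` K)"
  shows "covering_space S F D"
proof (rule covering_spaceI[OF cont surj])
  fix y assume "y \<in> D"
  define X where "X = S \<inter> F -` {y}"
  obtain U where U: "\<And>x. x \<in> S \<Longrightarrow> open (U x) \<and> x \<in> U x \<and> U x \<subseteq> S \<and> inj_on F (U x)"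
    using inj by metis
  have "compact X"
    unfolding X_def using \<open>y \<in> D\<close> by (intro proper) auto
  moreover have "X \<subseteq> (\<Union>x\<in>X. U x)" "\<And>x. x \<in> X \<Longrightarrow> open (U x)"
    using U by (auto simp: X_def)
  ultimately obtain X' where X': "X' \<subseteq> X" "finite X'" "X \<subseteq> (\<Union>x\<in>X'. U x)"
    by (meson compactE_image)
  have "X \<subseteq> X'"
  proof
    fix z assume "z \<in> X"
    then obtain x where "x \<in> X'" "z \<in> U x"
      using X' by blast
    moreover from this have "x \<in> U x" "inj_on F (U x)" "F z = F x"
      using U X'(1) \<open>z \<in> X\<close> by (auto simp: X_def)
    ultimately show "z \<in> X'"
      by (metis inj_onD)
  qed
  then have "finite X"
    using X'(2) finite_subset by blast
  \<comment> \<open>disjoint balls around the points of the fibre on which \<open>F\<close> is injective\<close>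
  have "\<exists>e>0. ball x e \<subseteq> U x \<and> (\<forall>x'\<in>X. x' \<noteq> x \<longrightarrow> 2 * e \<le> dist x x')" if "x \<in> X" for x
  proof -
    obtain e1 where e1: "0 < e1" "ball x e1 \<subseteq> U x"
      using U[of x] \<open>x \<in> X\<close> unfolding X_def by (meson IntE openE)
    obtain e2 where e2: "0 < e2" "\<forall>x'\<in>X. x' \<noteq> x \<longrightarrow> e2 \<le> dist x x'"
      using finite_set_avoid[OF \<open>finite X\<close>] by metis
    show ?thesis
      using e1 e2 by (intro exI[of _ "min e1 (e2 / 2)"]) (auto simp: subset_iff min_def)
  qed
  then obtain e where e: "\<And>x. x \<in> X \<Longrightarrow> 0 < e x" "\<And>x. x \<in> X \<Longrightarrow> ball x (e x) \<subseteq> U x"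
    "\<And>x x'. x \<in> X \<Longrightarrow> x' \<in> X \<Longrightarrow> x' \<noteq> x \<Longrightarrow> 2 * e x \<le> dist x x'"
    by metis
  have disj: "ball x (e x) \<inter> ball x' (e x') = {}" if x: "x \<in> X" "x' \<in> X" "x \<noteq> x'" for x x'
  proof -
    have "dist x x' \<ge> e x + e x'"
      using e(3)[of x x'] e(3)[of x' x] x by (auto simp: dist_commute)
    then show ?thesis
      by (simp add: disjoint_ballI)
  qed
  have ballS: "ball x (e x) \<subseteq> S" if "x \<in> X" for x
    using e(2) U that by (force simp: X_def)
  define B where "B = (\<Union>x\<in>X. ball x (e x))"
  obtain d where d: "0 < d" "cball y d \<subseteq> D"
    using \<open>open D\<close> \<open>y \<in> D\<close> open_contains_cball by blast
  \<comment> \<open>values within distance \<open>d\<close> of \<open>y\<close> that are taken outside these balls: a compact set, by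
    properness\<close>
  define M where "M = F ` (S \<inter> F -` cball y d - B)"
  have "compact (S \<inter> F -` cball y d - B)"
    using d by (intro compact_diff proper) (auto simp: B_def)
  then have "compact M"
    unfolding M_def by (intro compact_continuous_image continuous_on_subset[OF cont]) auto
  have "y \<notin> M"
    using e(1) by (force simp: M_def B_def X_def)
  define T where "T = (ball y d - M) \<inter> (\<Inter>x\<in>X. F ` ball x (e x))"
  have "open T"
    unfolding T_def using \<open>compact M\<close> \<open>finite X\<close> ballS
    by (intro open_Int open_Diff open_INT ballI locally_injective_open_map[OF cont _ _ inj])
      (auto simp: compact_imp_closed)
  have "y \<in> T"
    using \<open>y \<notin> M\<close> d e(1) by (force simp: T_def X_def)
  have "T \<subseteq> D"
    using d(2) by (force simp: T_def)
  let ?v = "(\<lambda>x. ball x (e x) \<inter> F -` T) ` X"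
  show "\<exists>T. y \<in> T \<and> openin (top_of_set D) T \<and>
          (\<exists>v. \<Union>v = S \<inter> F -` T \<and> (\<forall>u\<in>v. openin (top_of_set S) u) \<and>
            pairwise disjnt v \<and> (\<forall>u\<in>v. \<exists>q. homeomorphism u T F q))"
  proof (intro exI[of _ T] exI[of _ ?v] conjI ballI)
    show "y \<in> T" "openin (top_of_set D) T"
      using \<open>y \<in> T\<close> \<open>open T\<close> \<open>T \<subseteq> D\<close> by (auto intro: open_subset)
    have op: "open (ball x (e x) \<inter> F -` T)" if "x \<in> X" for x
      using \<open>open T\<close> ballS[OF that]
      by (intro continuous_open_preimage continuous_on_subset[OF cont]) auto
    show "\<Union>?v = S \<inter> F -` T"
    proof (intro equalityI subsetI)
      fix z assume "z \<in> S \<inter> F -` T"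
      moreover from this have "z \<in> B"
        by (auto simp: T_def M_def less_imp_le)
      ultimately show "z \<in> \<Union>?v"
        by (auto simp: B_def)
    qed (use ballS in \<open>auto simp: subset_iff\<close>)
    show "openin (top_of_set S) u" if "u \<in> ?v" for u
      using that op ballS by (auto intro!: open_subset)
    show "pairwise disjnt ?v"
      using disj by (fastforce simp: pairwise_def disjnt_def)
    show "\<exists>q. homeomorphism u T F q" if u: "u \<in> ?v" for u
    proof -
      obtain x where x: "x \<in> X" "u = ball x (e x) \<inter> F -` T"
        using u by blast
      have "inj_on F u"
        using e(2)[OF x(1)] U[of x] x by (auto simp: X_def intro: inj_on_subset)
      moreover have "T \<subseteq> F ` ball x (e x)"
        using x(1) by (auto simp: T_def)
      then have "F ` u = T"
        unfolding x(2) by blast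
      moreover have "u \<subseteq> S"
        using x ballS by auto
      then have "continuous_on u F"
        using continuous_on_subset[OF cont] by blast
      moreover have "open u"
        using op x by simp
      ultimately show ?thesis
        by (metis invariance_of_domain_homeomorphism order_refl)
    qed
  qed
qed

text \<open>The covering has a continuous section, since the target is simply connected; the image of
  the section is open and closed in the connected domain.\<close>

lemma proper_local_homeomorphism_bij:
  fixes F :: "'a::euclidean_space \<Rightarrow> 'a"
  assumes "open S" "connected S" "S \<noteq> {}" "open D" "convex D"
    and cont: "continuous_on S F" and FS: "F ` S \<subseteq> D"
    and inj: "\<And>x. x \<in> S \<Longrightarrow> \<exists>U. open U \<and> x \<in> U \<and> U \<subseteq> S \<and> inj_on F U"
    and proper: "\<And>K. compact K \<Longrightarrow> K \<subseteq> D \<Longrightarrow> compact (S \<inter> F -` K)"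
  shows "bij_betw F S D"
proof -
  have "open (F ` S)"
    using locally_injective_open_map[OF cont subset_refl assms(1) inj] .
  have "y \<in> F ` S" if y: "y \<in> D" "y \<in> closure (F ` S)" for y
  proof -
    obtain d where d: "0 < d" "cball y d \<subseteq> D"
      using \<open>open D\<close> y(1) open_contains_cball by blast
    let ?M = "F ` (S \<inter> F -` cball y d)"
    have "compact ?M"
      using d by (intro compact_continuous_image continuous_on_subset[OF cont] proper) auto
    have "y \<in> closure (ball y d \<inter> F ` S)"
      using open_Int_closure_subset[OF open_ball, of y d "F ` S"] y(2) d(1) by auto
    moreover have "closure (ball y d \<inter> F ` S) \<subseteq> ?M"
      using \<open>compact ?M\<close> by (intro closure_minimal compact_imp_closed) (auto simp: less_imp_le)
    ultimately show ?thesis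
      by blast
  qed
  then have "F ` S = D \<inter> closure (F ` S)"
    using FS closure_subset[of "F ` S"] by blast
  then have "closedin (top_of_set D) (F ` S)"
    using closed_closure closedin_closed by blast
  moreover have "openin (top_of_set D) (F ` S)"
    using FS \<open>open (F ` S)\<close> by (rule open_subset)
  ultimately have surj: "F ` S = D"
    using convex_connected[OF \<open>convex D\<close>] \<open>S \<noteq> {}\<close> unfolding connected_clopen by blast
  have cov: "covering_space S F D"
    using proper_local_homeomorphism_covering[OF assms(1,4) cont surj inj proper] .
  obtain a where a: "a \<in> S"
    using \<open>S \<noteq> {}\<close> by blast
  obtain s where s: "continuous_on D s" "s \<in> D \<rightarrow> S" "\<And>y. y \<in> D \<Longrightarrow> F (s y) = y"
  proof (rule covering_space_lift_strong[OF cov a, of "F a" D "\<lambda>y. y"])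
    show "F a \<in> D"
      using a surj by blast
  qed (use \<open>convex D\<close> in \<open>auto simp: convex_imp_simply_connected convex_imp_locally_path_connected\<close>)
  have "inj_on s D"
    using s(3) by (metis inj_onI)
  then have "open (s ` D)"
    using invariance_of_domain[OF s(1) \<open>open D\<close>] by simp
  then have "openin (top_of_set S) (s ` D)"
    using s(2) by (intro open_subset) auto
  moreover have "closedin (top_of_set S) (s ` D)"
  proof -
    have "s ` D = {z \<in> S. s (F z) - z = 0}"
    proof (intro equalityI subsetI)
      fix z assume "z \<in> s ` D"
      then obtain y where "y \<in> D" "z = s y"
        by blast
      then show "z \<in> {z \<in> S. s (F z) - z = 0}"
        using s(2) s(3)[of y] by auto
    next
      fix z assume "z \<in> {z \<in> S. s (F z) - z = 0}"
      then show "z \<in> s ` D"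
        using surj by (intro image_eqI[of _ _ "F z"]) auto
    qed
    moreover have "continuous_on S (\<lambda>z. s (F z) - z)"
      using surj by (intro continuous_intros continuous_on_compose2[OF s(1) cont]) auto
    ultimately show ?thesis
      using continuous_closedin_preimage_constant[of S "\<lambda>z. s (F z) - z" 0] by simp
  qed
  moreover have "s ` D \<noteq> {}"
    using a surj by blast
  ultimately have "s ` D = S"
    using \<open>connected S\<close> unfolding connected_clopen by blast
  then have "s (F z) = z" if "z \<in> S" for z
    using s(3) that by force
  then have "inj_on F S"
    by (rule inj_on_inverseI)
  then show ?thesis
    using surj by (simp add: bij_betw_def)
qed

section \<open>Smooth bijections of plane domains\<close>

text \<open>The bilinear form \<open>(\<i> * u) \<bullet> v\<close> is the determinant of the real matrix with columns \<open>u\<close>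
  and \<open>v\<close>; a linear system is solved by Cramer's rule.\<close>

lemma cramer_plane:
  assumes "(\<i> * u) \<bullet> v \<noteq> 0"
  shows "(((\<i> * w) \<bullet> v) * inverse ((\<i> * u) \<bullet> v)) *\<^sub>R u
       + (((\<i> * u) \<bullet> w) * inverse ((\<i> * u) \<bullet> v)) *\<^sub>R v = w"
proof -
  have "(((\<i> * w) \<bullet> v) *\<^sub>R u + ((\<i> * u) \<bullet> w) *\<^sub>R v) = ((\<i> * u) \<bullet> v) *\<^sub>R w"
    by (simp add: complex_eq_iff inner_complex_def algebra_simps)
  then have "inverse ((\<i> * u) \<bullet> v) *\<^sub>R (((\<i> * w) \<bullet> v) *\<^sub>R u + ((\<i> * u) \<bullet> w) *\<^sub>R v) = w"
    using assms by simp
  then show ?thesis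
    by (simp only: scaleR_add_right scaleR_scaleR mult.commute)
qed

text \<open>A smooth map with nowhere vanishing Jacobian determinant on an open set. The inverse of its
  derivative is written out by Cramer's rule, so that its smoothness in the base point is visible.\<close>

locale nondegenerate_plane_map =
  fixes S :: "complex set" and F :: "complex \<Rightarrow> complex"
  assumes open_S: "open S" and smooth: "\<And>k. Ck_on k S F"
    and nondegenerate: "\<And>z. z \<in> S \<Longrightarrow>
      (\<i> * frechet_derivative F (at z) 1) \<bullet> frechet_derivative F (at z) \<i> \<noteq> 0"
begin

abbreviation "D z \<equiv> frechet_derivative F (at z)"
abbreviation "J z \<equiv> (\<i> * D z 1) \<bullet> D z \<i>"

text \<open>\<open>D_inverse z\<close> is the inverse of the derivative at \<open>z\<close>.\<close>

definition D_inverse :: "complex \<Rightarrow> complex \<Rightarrow> complex" where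
  "D_inverse z w = (((\<i> * w) \<bullet> D z \<i>) * inverse (J z)) *\<^sub>R 1 + (((\<i> * D z 1) \<bullet> w) * inverse (J z)) *\<^sub>R \<i>"

lemma derivative: "z \<in> S \<Longrightarrow> (F has_derivative D z) (at z)"
  using Ck_on_has_derivative[OF smooth[of "Suc 0"]] .

lemma D_D_inverse:
  assumes "z \<in> S"
  shows "D z (D_inverse z w) = w"
proof -
  have "D z (D_inverse z w) = Re (D_inverse z w) *\<^sub>R D z 1 + Im (D_inverse z w) *\<^sub>R D z \<i>"
    by (rule linear_complex_expansion[OF has_derivative_linear[OF derivative[OF assms]]])
  also have "Re (D_inverse z w) = ((\<i> * w) \<bullet> D z \<i>) * inverse (J z)"
    by (simp add: D_inverse_def)
  also have "Im (D_inverse z w) = ((\<i> * D z 1) \<bullet> w) * inverse (J z)"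
    by (simp add: D_inverse_def)
  finally show ?thesis
    using cramer_plane[OF nondegenerate[OF assms]] by (rule trans)
qed

lemma linear_D_inverse: "linear (D_inverse z)"
  by (rule linearI) (simp_all add: D_inverse_def algebra_simps inner_add_left inner_add_right complex_eq_iff)

lemma Ck_on_D: "Ck_on k S (\<lambda>z. D z v)"
  using smooth[of "Suc k"] by simp

lemma Ck_on_D_inverse: "Ck_on k S (\<lambda>z. D_inverse z w)"
proof -
  have det: "Ck_on k S (\<lambda>z. (\<i> * f z) \<bullet> g z)" if "Ck_on k S f" "Ck_on k S g" for f g
    using that open_S
    by (intro Ck_on_bilinear[OF bounded_bilinear_inner]
        Ck_on_bounded_linear[OF bounded_linear_mult_right])
  show ?thesis
    unfolding D_inverse_def
    by (intro Ck_on_add[OF open_S] Ck_on_bilinear[OF bounded_bilinear_scaleR open_S]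
        Ck_on_bilinear[OF bounded_bilinear_mult open_S] Ck_on_inverse[OF open_S] det
        Ck_on_D Ck_on_const nondegenerate)
qed

lemma continuous: "continuous_on S F"
  using smooth[of 0] by simp

text \<open>The derivative depends continuously on the point in operator norm, because it is determined
  by the two partial derivatives.\<close>

lemma locally_injective:
  assumes "a \<in> S"
  shows "\<exists>U. open U \<and> a \<in> U \<and> U \<subseteq> S \<and> inj_on F U"
proof -
  have lin: "linear (D z)" if "z \<in> S" for z
    using has_derivative_linear[OF derivative[OF that]] .
  have left: "D_inverse a \<circ> D a = id"
    using D_D_inverse[OF assms] linear_inverse_left[OF linear_D_inverse lin[OF assms], of a]
    by (auto simp: fun_eq_iff)
  have close: "\<exists>d>0. \<forall>x. dist a x < d \<longrightarrow> onorm (\<lambda>v. D x v - D a v) < e" if "e > 0" for e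
  proof -
    have "e / 3 > 0"
      using that by simp
    have "\<exists>d>0. \<forall>x\<in>S. dist x a < d \<longrightarrow> dist (D x v) (D a v) < e / 3" for v
    proof -
      have "continuous_on S (\<lambda>z. D z v)"
        using Ck_on_D[of 0 v] by simp
      then show ?thesis
        using assms \<open>e / 3 > 0\<close> unfolding continuous_on_iff by blast
    qed
    then obtain d where d: "\<And>v. d v > 0"
      "\<And>v x. x \<in> S \<Longrightarrow> dist x a < d v \<Longrightarrow> dist (D x v) (D a v) < e / 3"
      by metis
    obtain r where r: "r > 0" "ball a r \<subseteq> S"
      using assms open_S openE by blast
    have "onorm (\<lambda>v. D x v - D a v) < e" if x: "dist a x < min r (min (d 1) (d \<i>))" for x
    proof -
      have "x \<in> S"
        using x r(2) by auto
      have "norm (D x v - D a v) \<le> (2 * e / 3) * norm v" for v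
      proof -
        have "D x v - D a v = Re v *\<^sub>R (D x 1 - D a 1) + Im v *\<^sub>R (D x \<i> - D a \<i>)"
          using linear_complex_expansion[OF lin[OF \<open>x \<in> S\<close>], of v]
            linear_complex_expansion[OF lin[OF assms], of v]
          by (simp add: algebra_simps)
        then have "norm (D x v - D a v) \<le> norm (Re v *\<^sub>R (D x 1 - D a 1)) + norm (Im v *\<^sub>R (D x \<i> - D a \<i>))"
          by (metis norm_triangle_ineq)
        also have "\<dots> = \<bar>Re v\<bar> * dist (D x 1) (D a 1) + \<bar>Im v\<bar> * dist (D x \<i>) (D a \<i>)"
          by (simp add: dist_norm)
        also have "\<dots> \<le> norm v * (e / 3) + norm v * (e / 3)"
          using d(2)[OF \<open>x \<in> S\<close>, of 1] d(2)[OF \<open>x \<in> S\<close>, of \<i>] x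
          by (intro add_mono mult_mono abs_Re_le_cmod abs_Im_le_cmod) (auto simp: dist_commute)
        finally show ?thesis
          by simp
      qed
      then have "onorm (\<lambda>v. D x v - D a v) \<le> 2 * e / 3"
        by (rule onorm_le)
      then show ?thesis
        using \<open>e > 0\<close> by simp
    qed
    then show ?thesis
      using r(1) d(1) by (intro exI[of _ "min r (min (d 1) (d \<i>))"]) auto
  qed
  obtain r where "r > 0" "ball a r \<subseteq> S" "inj_on F (ball a r)"
    using has_derivative_locally_injective[OF assms open_S
        linear_conv_bounded_linear[THEN iffD1, OF linear_D_inverse] left derivative close] by metis
  then show ?thesis
    by (intro exI[of _ "ball a r"]) auto
qed

text \<open>The derivative of the inverse map \<open>G\<close> is \<open>D_inverse \<circ> G\<close>, which is as often differentiable
  as \<open>G\<close> is: a bootstrap argument.\<close>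

lemma smooth_inverse:
  assumes bij: "bij_betw F S T" and "open T"
  shows "Ck_on k T (inv_into S F)"
proof -
  let ?G = "inv_into S F"
  have inv: "?G (F z) = z" if "z \<in> S" for z
    using bij that by (simp add: bij_betw_def)
  have GS: "?G y \<in> S" "F (?G y) = y" if "y \<in> T" for y
    using bij that by (auto simp: bij_betw_def inv_into_into f_inv_into_f)
  have der: "(?G has_derivative (\<lambda>w. D_inverse (?G y) w)) (at y)" if "y \<in> T" for y
  proof -
    have "(?G has_derivative D_inverse (?G y)) (at (F (?G y)))"
    proof (rule has_derivative_inverse_strong[OF open_S GS(1)[OF that] continuous])
      show "(F has_derivative D (?G y)) (at (?G y))"
        using derivative[OF GS(1)[OF that]] .
      show "D (?G y) \<circ> D_inverse (?G y) = id"
        using D_D_inverse[OF GS(1)[OF that]] by (auto simp: fun_eq_iff)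
    qed (rule inv)
    then show ?thesis
      using GS(2)[OF that] by simp
  qed
  show ?thesis
  proof (induction k)
    case 0
    have "continuous_on T ?G"
      by (intro continuous_at_imp_continuous_on ballI has_derivative_continuous[OF der])
    then show ?case
      by simp
  next
    case (Suc k)
    show ?case
      using GS(1)
      by (intro Ck_on_has_derivativeI[OF \<open>open T\<close> der]
          Ck_on_compose[OF open_S \<open>open T\<close> _ Ck_on_D_inverse Suc]) auto
  qed
qed

end

section \<open>Harmonic barycentric mappings\<close>

text \<open>Linearity on the edges makes the map send one closed polygonal path to the other, point by
  point in the parameter; hence it is a homeomorphism between the boundaries.\<close>

lemma gbc_boundary_map:
  assumes gbc: "gbc_functions V vs \<phi>" and len: "length ws = length vs" "3 \<le> length vs"
    and t: "0 \<le> t" "t \<le> 1"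
  shows "(\<Sum>i<length vs. \<phi> i (closed_polyline vs t) *\<^sub>R ws ! i) = closed_polyline ws t"
proof -
  let ?n = "length vs"
  define F where "F = (\<lambda>z. \<Sum>i<?n. \<phi> i z *\<^sub>R ws ! i)"
  have vertex: "F (vs ! j) = ws ! j" if "j < ?n" for j
  proof -
    have "F (vs ! j) = (\<Sum>i<?n. if i = j then ws ! i else 0)"
      unfolding F_def using gbc that by (intro sum.cong) (auto simp: gbc_functions_def)
    then show ?thesis
      using that by simp
  qed
  have "F (polyline (vs @ [hd vs]) t) = polyline (ws @ [hd ws]) t"
  proof (rule polyline_image)
    fix j s assume j: "Suc j < length (vs @ [hd vs])" and s: "0 \<le> s" "(s::real) \<le> 1"
    let ?k = "Suc j mod ?n"
    have "?n > 0"
      using len by auto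
    have nth: "(us @ [hd us]) ! j = us ! j" "(us @ [hd us]) ! Suc j = us ! ?k"
      if "length us = ?n" for us :: "complex list"
    proof -
      have "hd us = us ! 0"
        using that \<open>?n > 0\<close> by (cases us) auto
      then show "(us @ [hd us]) ! j = us ! j" "(us @ [hd us]) ! Suc j = us ! ?k"
        using j that \<open>?n > 0\<close> by (auto simp: nth_append less_Suc_eq)
    qed
    have "\<phi> i (linepath (vs ! j) (vs ! ?k) s) = (1 - s) * \<phi> i (vs ! j) + s * \<phi> i (vs ! ?k)"
      if "i < ?n" for i
      using gbc that j s by (auto simp: gbc_functions_def linear_on_segment_def linepath_def)
    then have "F (linepath (vs ! j) (vs ! ?k) s) = (1 - s) *\<^sub>R F (vs ! j) + s *\<^sub>R F (vs ! ?k)"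
      by (simp add: F_def scaleR_add_left scaleR_sum_right sum.distrib)
    then show "F (linepath ((vs @ [hd vs]) ! j) ((vs @ [hd vs]) ! Suc j) s) =
        linepath ((ws @ [hd ws]) ! j) ((ws @ [hd ws]) ! Suc j) s"
      using j \<open>?n > 0\<close> len(1) by (simp add: nth vertex linepath_def)
  qed (use len t in auto)
  then show ?thesis
    by (simp add: closed_polyline_def F_def)
qed

lemma frontier_not_in_line:
  fixes W :: "complex set"
  assumes "bounded W" "interior W \<noteq> {}" "d \<noteq> 0"
  obtains w w' where "w \<in> frontier W" "w' \<in> frontier W" "d \<bullet> w \<noteq> d \<bullet> w'"
proof -
  obtain p where p: "p \<in> interior W"
    using assms(2) by blast
  obtain s where s: "0 < s" "p + s *\<^sub>R d \<in> frontier W"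
    using ray_to_frontier[OF assms(1) p assms(3)] by metis
  obtain s' where s': "0 < s'" "p + s' *\<^sub>R (- d) \<in> frontier W"
    using ray_to_frontier[OF assms(1) p, of "- d"] assms(3) by (metis neg_equal_0_iff_equal)
  have "d \<bullet> (p + s *\<^sub>R d) - d \<bullet> (p + s' *\<^sub>R (- d)) = (s + s') * (d \<bullet> d)"
    by (simp add: inner_simps algebra_simps)
  moreover have "(s + s') * (d \<bullet> d) \<noteq> 0"
    using s s' assms(3) by simp
  ultimately show thesis
    using that[OF s(2) s'(2)] by force
qed

text \<open>A map of a polygon, harmonic inside, that maps the boundary homeomorphically onto the boundary
  of a convex region. Harmonicity is stated as smoothness together with a holomorphic gradient for
  each coordinate \<open>d \<bullet> F\<close> of the map in a fixed direction \<open>d\<close>.\<close>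

locale harmonic_extension =
  fixes V W :: "complex set" and F :: "complex \<Rightarrow> complex"
  assumes V: "compact V" "interior V \<noteq> {}" "connected (interior V)" "frontier (interior V) = frontier V"
    and W: "convex W" "compact W" "interior W \<noteq> {}"
    and cont: "continuous_on V F"
    and harmonic: "\<And>d c. \<exists>f. holomorphic_gradient (interior V) (\<lambda>z. d \<bullet> F z + c) f"
    and smooth: "\<And>k. Ck_on k (interior V) F"
    and range: "F ` V \<subseteq> W"
    and boundary: "F ` frontier V = frontier W" "inj_on F (frontier V)"
begin

text \<open>Otherwise the boundary of \<open>W\<close> would lie on a line.\<close>

lemma not_constant:
  assumes "d \<noteq> 0"
  shows "\<exists>b\<in>interior V. d \<bullet> F b \<noteq> c"
proof (rule ccontr)
  assume "\<not> ?thesis"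
  then have const: "d \<bullet> F z = c" if "z \<in> interior V" for z
    using that by blast
  have clV: "closure (interior V) \<subseteq> V"
    using V(1) by (intro closure_minimal interior_subset compact_imp_closed)
  have "d \<bullet> F z = c" if "z \<in> closure (interior V)" for z
  proof (rule continuous_constant_on_closure[OF _ const that])
    show "continuous_on (closure (interior V)) (\<lambda>z. d \<bullet> F z)"
      using continuous_on_subset[OF cont clV] by (intro continuous_intros)
  qed
  then have "d \<bullet> w = c" if "w \<in> frontier W" for w
    using that V(4) unfolding boundary(1)[symmetric] by (auto simp: frontier_def)
  then show False
    using frontier_not_in_line[OF compact_imp_bounded[OF W(2)] W(3) assms] by metis
qed

text \<open>At a point sent to the boundary of \<open>W\<close>, the coordinate normal to a supporting line would
  have an interior extremum.\<close>

lemma into_interior: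
  assumes a: "a \<in> interior V"
  shows "F a \<in> interior W"
proof (rule ccontr)
  assume "F a \<notin> interior W"
  then have "F a \<notin> rel_interior W"
    using W(3) by (simp add: rel_interior_nonempty_interior)
  moreover have "F a \<in> W"
    using a range interior_subset by blast
  ultimately obtain d where d: "d \<noteq> 0" "\<And>y. y \<in> W \<Longrightarrow> d \<bullet> F a \<le> d \<bullet> y"
    using supporting_hyperplane_rel_boundary[OF W(1)] by metis
  obtain f where f: "holomorphic_gradient (interior V) (\<lambda>z. (- d) \<bullet> F z + 0) f"
    using harmonic by blast
  have "(- d) \<bullet> F z + 0 = (- d) \<bullet> F a + 0" if "z \<in> interior V" for z
  proof (rule harmonic_maximum_principle[OF open_interior V(3) f a _ that])
    fix x assume "x \<in> interior V"
    then have "F x \<in> W"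
      using range interior_subset by blast
    then show "(- d) \<bullet> F x + 0 \<le> (- d) \<bullet> F a + 0"
      using d(2) by simp
  qed
  then show False
    using not_constant[OF d(1), of "d \<bullet> F a"] by auto
qed

text \<open>If the Jacobian vanishes at \<open>a\<close>, some coordinate \<open>h\<close>, normalised to vanish at \<open>a\<close>, has a
  critical point there. Its zero line passes through the interior point \<open>F a\<close> of \<open>W\<close> and cuts the
  boundary of the convex set \<open>W\<close> into two connected pieces.\<close>

lemma jacobian_nonzero:
  assumes a: "a \<in> interior V"
  shows "(\<i> * frechet_derivative F (at a) 1) \<bullet> frechet_derivative F (at a) \<i> \<noteq> 0"
proof
  let ?u = "frechet_derivative F (at a) 1" and ?v = "frechet_derivative F (at a) \<i>"
  assume det: "(\<i> * ?u) \<bullet> ?v = 0"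
  \<comment> \<open>a direction normal to both partial derivatives\<close>
  obtain d where d: "d \<noteq> 0" "d \<bullet> ?u = 0" "d \<bullet> ?v = 0"
  proof (cases "?u = 0")
    case True
    show thesis
    proof (cases "?v = 0")
      case True
      then show thesis
        using that[of 1] \<open>?u = 0\<close> by simp
    next
      case False
      then show thesis
        using that[of "\<i> * ?v"] \<open>?u = 0\<close> by (simp add: inner_complex_def)
    qed
  next
    case False
    then show thesis
      using that[of "\<i> * ?u"] det by (simp add: inner_complex_def)
  qed
  define h where "h = (\<lambda>z. d \<bullet> F z + (- (d \<bullet> F a)))"
  have h_eq: "h z = d \<bullet> (F z - F a)" for z
    by (simp add: h_def inner_diff_right)
  obtain f where f: "holomorphic_gradient (interior V) h f"
    unfolding h_def using harmonic by blast
  obtain b where b: "b \<in> interior V" "h b \<noteq> 0"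
    using not_constant[OF d(1), of "d \<bullet> F a"] by (auto simp: h_def)
  have F': "(F has_derivative frechet_derivative F (at a)) (at a)"
    using Ck_on_has_derivative[OF smooth[of "Suc 0"] a] .
  have "(h has_derivative (\<lambda>v. d \<bullet> frechet_derivative F (at a) v + 0)) (at a)"
    unfolding h_def by (intro has_derivative_add has_derivative_inner_right F' has_derivative_const)
  moreover have "(h has_derivative (\<lambda>v. Re (f a * v))) (at a)"
    using f a by (simp add: holomorphic_gradient_def)
  ultimately have "(\<lambda>v. d \<bullet> frechet_derivative F (at a) v + 0) = (\<lambda>v. Re (f a * v))"
    by (rule has_derivative_unique)
  then have "Re (f a * 1) = 0" "Re (f a * \<i>) = 0"
    using d(2,3) by (metis add.right_neutral)+
  then have "f a = 0"
    by (simp add: complex_eq_iff)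
  moreover have "f a \<noteq> 0"
  proof (rule no_critical_zero[OF V(1,3) _ f _ _ a _ b])
    show "continuous_on V h"
      unfolding h_def by (intro continuous_intros cont)
    have half: "connected {z \<in> frontier V. n \<bullet> (F z - F a) > 0}" for n
      using V(1) W frontier_subset_compact[OF V(1)]
      by (intro connected_boundary_halfplane[of W] into_interior a boundary
          continuous_on_subset[OF cont] compact_frontier compact_imp_bounded)
    show "connected {z \<in> frontier V. h z > 0}" "connected {z \<in> frontier V. h z < 0}"
      using half[of d] half[of "- d"] by (simp_all add: h_eq)
    show "h a = 0"
      by (simp add: h_eq)
  qed
  ultimately show False
    by simp
qed

sublocale nondegenerate_plane_map "interior V" F
  using smooth jacobian_nonzero by unfold_locales auto

text \<open>Properness holds because boundary points are sent to boundary points.\<close>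

lemma bij_betw_interiors: "bij_betw F (interior V) (interior W)"
proof (rule proper_local_homeomorphism_bij)
  show "compact (interior V \<inter> F -` K)" if K: "compact K" "K \<subseteq> interior W" for K
  proof -
    have "F z \<notin> K" if "z \<in> frontier V" for z
      using boundary(1) that K(2) by (force simp: frontier_def)
    then have "interior V \<inter> F -` K = V \<inter> F -` K"
      using interior_subset[of V] compact_imp_closed[OF V(1)] by (auto simp: frontier_def)
    moreover have "closed (V \<inter> F -` K)"
      using cont V(1) K(1) by (intro continuous_closed_preimage compact_imp_closed)
    moreover have "bounded (V \<inter> F -` K)"
      using V(1) by (intro bounded_subset[OF compact_imp_bounded]) auto
    ultimately show ?thesis
      by (simp add: compact_eq_bounded_closed)
  qed
  show "continuous_on (interior V) F"
    using continuous_on_subset[OF cont interior_subset] .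
  show "F ` interior V \<subseteq> interior W"
    using into_interior by blast
  show "\<exists>U. open U \<and> x \<in> U \<and> U \<subseteq> interior V \<and> inj_on F U" if "x \<in> interior V" for x
    using locally_injective[OF that] .
qed (use V W in \<open>auto simp: convex_interior\<close>)

lemma diffeomorphism: "diffeomorphism (interior V) (interior W) F"
  using bij_betw_interiors smooth smooth_inverse[OF bij_betw_interiors open_interior]
  by (simp add: diffeomorphism_def smooth_on_def)

end

theorem mainTheorem4:
  fixes V W :: "complex set" and vs ws :: "complex list"
    and \<phi> :: "nat \<Rightarrow> complex \<Rightarrow> real"
  assumes "polygon V vs" and "polygon W ws"
    and "length ws = length vs"
    and "counterclockwise V vs" and "counterclockwise W ws"
    and "convex W"
    and "harmonic_gbc_functions V vs \<phi>"
  shows "diffeomorphism (interior V) (interior W)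
           (\<lambda>z. \<Sum>i<length vs. \<phi> i z *\<^sub>R ws ! i)"
proof -
  let ?n = "length vs"
  define F where "F = (\<lambda>z. \<Sum>i<?n. \<phi> i z *\<^sub>R ws ! i)"
  have gbc: "gbc_functions V vs \<phi>" and cont: "\<And>i. i < ?n \<Longrightarrow> continuous_on V (\<phi> i)"
    and har: "\<And>i. i < ?n \<Longrightarrow> harmonic_on (interior V) (\<phi> i)"
    using assms(7) by (auto simp: harmonic_gbc_functions_def)
  have V: "compact V" "interior V \<noteq> {}" "frontier V = path_image (closed_polyline vs)" "3 \<le> ?n"
    and sV: "simple_path (closed_polyline vs)"
    using assms(1) by (auto simp: polygon_def)
  have W: "compact W" "interior W \<noteq> {}" "frontier W = path_image (closed_polyline ws)"
    and sW: "simple_path (closed_polyline ws)"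
    using assms(2) by (auto simp: polygon_def)
  have "\<exists>g. \<forall>i\<in>{..<?n}. holomorphic_gradient (interior V) (\<phi> i) (g i)"
    using harmonic_on_imp_holomorphic_gradient[OF open_interior har] by (intro bchoice) blast
  then obtain g where g: "\<And>i. i \<in> {..<?n} \<Longrightarrow> holomorphic_gradient (interior V) (\<phi> i) (g i)"
    by blast
  have path: "F (closed_polyline vs t) = closed_polyline ws t" if "t \<in> {0..1}" for t
    using gbc_boundary_map[OF gbc assms(3) V(4)] that by (simp add: F_def)
  have "harmonic_extension V W F"
  proof
    show "continuous_on V F"
      unfolding F_def using cont by (intro continuous_intros) auto
    show "\<exists>f. holomorphic_gradient (interior V) (\<lambda>z. d \<bullet> F z + c) f" for d c
    proof -
      have "d \<bullet> F z + c = (\<Sum>i<?n. \<phi> i z * (d \<bullet> ws ! i)) + c" for z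
        by (simp add: F_def inner_sum_right)
      then show ?thesis
        using holomorphic_gradient_linear_combination[of "{..<?n}" "interior V" \<phi> g "\<lambda>i. d \<bullet> ws ! i" c] g
        by auto
    qed
    show "Ck_on k (interior V) F" for k
      unfolding F_def using holomorphic_gradient_Ck_on[OF open_interior g]
      by (intro Ck_on_sum Ck_on_bilinear[OF bounded_bilinear_scaleR] Ck_on_const open_interior)
    show "F ` V \<subseteq> W"
    proof
      fix w assume "w \<in> F ` V"
      then obtain z where z: "z \<in> V" "w = F z"
        by blast
      have "set ws \<subseteq> path_image (closed_polyline ws)"
        using polyline_vertices[of "ws @ [hd ws]"] by (simp add: closed_polyline_def)
      then have "set ws \<subseteq> W"
        using W(3) frontier_subset_compact[OF W(1)] by blast
      then have "ws ! i \<in> W" if "i < ?n" for i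
        using that assms(3) nth_mem by force
      then show "w \<in> W"
        using gbc z unfolding F_def gbc_functions_def
        by (auto intro!: convex_sum[OF _ assms(6)])
    qed
    show "F ` frontier V = frontier W"
      unfolding V(3) W(3) path_image_def image_image using path by (intro image_cong) auto
    show "inj_on F (frontier V)"
    proof (rule inj_onI)
      fix x y assume "x \<in> frontier V" "y \<in> frontier V" and eq: "F x = F y"
      then obtain s t where st: "s \<in> {0..1}" "t \<in> {0..1}"
        "x = closed_polyline vs s" "y = closed_polyline vs t"
        unfolding V(3) path_image_def by blast
      then have "closed_polyline ws s = closed_polyline ws t"
        using eq path by metis
      then have "s = t \<or> s = 0 \<and> t = 1 \<or> s = 1 \<and> t = 0"
        using sW st(1,2) unfolding simple_path_def loop_free_def by blast
      moreover have "vs \<noteq> []"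
        using V(4) by auto
      then have "closed_polyline vs 1 = closed_polyline vs 0"
        using closed_polyline_loop[of vs] by (simp add: pathstart_def pathfinish_def)
      ultimately show "x = y"
        using st by auto
    qed
  qed (use V W assms(6) polygon_interior_connected[OF assms(1)] in auto)
  then show ?thesis
    using harmonic_extension.diffeomorphism unfolding F_def by blast
qed

end
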